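(* Let $g=(x,t)\in N_{3,2}$ with $x=0$ and $t\ne0$. Then $$p_h(x,t)=\mathbf C\,4\pi^4\,h^{-7/2}\,|t|^{-1}\,e^{-\frac{d(g)^2}{4h}}\,(1+o_g(1))\qquad\text{as }h\to0^+,$$ where $o_g(1)\to0$ as $h\to0^+$ for fixed $g$.
   Context: $N_{3,2}=\mathbb R^3\times\mathbb R^3$ with $(x,t)\cdot(x',t')=(x+x',\,t+t'-\tfrac12x\times x')$ ($\times$ = cross product). Left-invariant fields: $X_1=\partial_{x_1}-\tfrac12x_3\partial_{t_2}+\tfrac12x_2\partial_{t_3}$, $X_2=\partial_{x_2}+\tfrac12x_3\partial_{t_1}-\tfrac12x_1\partial_{t_3}$, $X_3=\partial_{x_3}-\tfrac12x_2\partial_{t_1}+\tfrac12x_1\partial_{t_2}$; $\Delta=X_1^2+X_2^2+X_3^2$. $d(g)$ is the Carnot--Carathéodory distance from the identity to $g$ (infimum of lengths of horizontal curves, $X_1,X_2,X_3$ orthonormal). The heat kernel of $\partial_h-\Delta$ (with respect to Lebesgue measure) is $p_h(x,t)=\mathbf C\,h^{-9/2}\,p(x/\sqrt h,t/h)$ with a positive (normalizing) constant $\mathbf C$ and $$p(x,t)=\int_{\mathbb R^3}\frac{|\lambda|}{\sinh|\lambda|}\exp\Big\{-\tfrac14\Big[|x|^2+\tfrac{|\lambda|\coth|\lambda|-1}{|\lambda|^2}\big(|\lambda|^2|x|^2-(\lambda\cdot x)^2\big)-4i\,t\cdot\lambda\Big]\Big\}d\lambda .$$ *)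

theory Defs
  imports "HOL-Analysis.Analysis"
begin

type_synonym n32 = "(real^3) \<times> (real^3)"

definition n32_mult :: "n32 \<Rightarrow> n32 \<Rightarrow> n32" where
  "n32_mult g g' = (fst g + fst g', snd g + snd g' - (1/2) *\<^sub>R cross3 (fst g) (fst g'))"

text \<open>A vector field is given by its coefficients with respect to
  $\partial_{x_1},\partial_{x_2},\partial_{x_3}$ (first component) and
  $\partial_{t_1},\partial_{t_2},\partial_{t_3}$ (second component).\<close>

definition X1 :: "n32 \<Rightarrow> n32" where
  "X1 g = (vector [1, 0, 0], vector [0, - (1/2) * fst g $ 3, (1/2) * fst g $ 2])"

definition X2 :: "n32 \<Rightarrow> n32" where
  "X2 g = (vector [0, 1, 0], vector [(1/2) * fst g $ 3, 0, - (1/2) * fst g $ 1])"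

definition X3 :: "n32 \<Rightarrow> n32" where
  "X3 g = (vector [0, 0, 1], vector [- (1/2) * fst g $ 2, (1/2) * fst g $ 1, 0])"

text \<open>These are the left-invariant fields of the group law: each is the velocity at
  \<open>s = 0\<close> of right multiplication by a straight line through the identity.\<close>

lemma X_left_invariant:
  "((\<lambda>s. n32_mult g (s *\<^sub>R vector [1, 0, 0], 0)) has_vector_derivative X1 g) (at 0)"
  "((\<lambda>s. n32_mult g (s *\<^sub>R vector [0, 1, 0], 0)) has_vector_derivative X2 g) (at 0)"
  "((\<lambda>s. n32_mult g (s *\<^sub>R vector [0, 0, 1], 0)) has_vector_derivative X3 g) (at 0)"
proof -
  have *: "((\<lambda>s. n32_mult g (s *\<^sub>R v, 0)) has_vector_derivative
      (v, - (1/2) *\<^sub>R cross3 (fst g) v)) (at 0)" for v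
  proof -
    have "(\<lambda>s. n32_mult g (s *\<^sub>R v, 0)) =
        (\<lambda>s. g + s *\<^sub>R (v, - (1/2) *\<^sub>R cross3 (fst g) v))"
      by (rule ext) (simp add: n32_mult_def prod_eq_iff cross_mult_right)
    then show ?thesis
      by (auto intro!: derivative_eq_intros)
  qed
  have "X1 g = (vector [1, 0, 0], - (1/2) *\<^sub>R cross3 (fst g) (vector [1, 0, 0]))"
    "X2 g = (vector [0, 1, 0], - (1/2) *\<^sub>R cross3 (fst g) (vector [0, 1, 0]))"
    "X3 g = (vector [0, 0, 1], - (1/2) *\<^sub>R cross3 (fst g) (vector [0, 0, 1]))"
    by (simp_all add: X1_def X2_def X3_def cross3_def vec_eq_iff forall_3)
  then show
    "((\<lambda>s. n32_mult g (s *\<^sub>R vector [1, 0, 0], 0)) has_vector_derivative X1 g) (at 0)"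
    "((\<lambda>s. n32_mult g (s *\<^sub>R vector [0, 1, 0], 0)) has_vector_derivative X2 g) (at 0)"
    "((\<lambda>s. n32_mult g (s *\<^sub>R vector [0, 0, 1], 0)) has_vector_derivative X3 g) (at 0)"
    by (simp_all only: *)
qed

text \<open>An absolutely continuous curve on \<open>[0,1]\<close> with
  $\gamma' = a_1 X_1(\gamma) + a_2 X_2(\gamma) + a_3 X_3(\gamma)$ almost everywhere.  Absolute
  continuity together with the a.e. equation is expressed in integrated form; \<open>\<gamma>\<close> being
  bounded, \<open>\<gamma>'\<close> is Lebesgue integrable exactly when the control \<open>a\<close> is.\<close>

definition horizontal_curve :: "(real \<Rightarrow> real^3) \<Rightarrow> (real \<Rightarrow> n32) \<Rightarrow> bool" where
  "horizontal_curve a \<gamma> \<longleftrightarrow>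
     continuous_on {0..1} \<gamma> \<and> a absolutely_integrable_on {0..1} \<and>
     (\<forall>s\<in>{0..1}. ((\<lambda>u. a u $ 1 *\<^sub>R X1 (\<gamma> u) + a u $ 2 *\<^sub>R X2 (\<gamma> u) + a u $ 3 *\<^sub>R X3 (\<gamma> u))
        has_integral (\<gamma> s - \<gamma> 0)) {0..s})"

text \<open>The length of the curve with control \<open>a\<close>, the frame $X_1, X_2, X_3$ being orthonormal.\<close>

definition horizontal_length :: "(real \<Rightarrow> real^3) \<Rightarrow> real" where
  "horizontal_length a = integral {0..1} (\<lambda>s. sqrt ((a s $ 1)\<^sup>2 + (a s $ 2)\<^sup>2 + (a s $ 3)\<^sup>2))"

definition cc_dist :: "n32 \<Rightarrow> real" where
  "cc_dist g = Inf {horizontal_length a | a \<gamma>.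
     horizontal_curve a \<gamma> \<and> \<gamma> 0 = (0, 0) \<and> \<gamma> 1 = g}"

text \<open>The integration variable is \<open>l\<close>.  At \<open>l = 0\<close>, a null set, the library's division by zero
  gives the integrand a value other than its continuous extension.\<close>

definition p_kernel :: "real^3 \<Rightarrow> real^3 \<Rightarrow> complex" where
  "p_kernel x t = (LINT l|lborel.
     complex_of_real (norm l / sinh (norm l)) *
     exp (- (1/4) * (complex_of_real ((norm x)\<^sup>2 +
            (norm l * (cosh (norm l) / sinh (norm l)) - 1) / (norm l)\<^sup>2 *
            ((norm l)\<^sup>2 * (norm x)\<^sup>2 - (l \<bullet> x)\<^sup>2))
          - 4 * \<i> * complex_of_real (t \<bullet> l))))"

text \<open>The heat kernel of $\partial_h - \Delta$ with respect to Lebesgue measure, when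
  \<open>C\<close> is the positive constant normalizing its total mass to 1.\<close>

definition heat_kernel :: "real \<Rightarrow> real \<Rightarrow> real^3 \<Rightarrow> real^3 \<Rightarrow> complex" where
  "heat_kernel C h x t =
     complex_of_real (C * h powr (- 9/2)) * p_kernel ((1 / sqrt h) *\<^sub>R x) ((1 / h) *\<^sub>R t)"

end

(* The vertical point (0, t) lies at distance d with d^2 = 4 pi |t|: the t-component of a
   horizontal curve records the area swept out by its projection, so this is the isoperimetric
   inequality, proved by calibration and attained by a circle.
   On the kernel side, p(0, t) is the Fourier transform of the radial function r / sinh r on R^3,
   hence a one-dimensional sine integral.  Expanding 1 / sinh r in exponentials turns it into a
   polygamma series, and the reflection formula gives
     p(0, t) = pi^4 / |t| * sinh y / cosh y ^ 3,   y = pi |t| / 2,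
   which behaves like 4 pi^4 / |t| * exp (- pi |t|).  Scaling t by 1 / h yields the claim. *)

theory Submission
  imports Defs "HOL-Real_Asymp.Real_Asymp"
begin

section \<open>The distance to a vertical point\<close>

text \<open>Controls are merely integrable, so a horizontal curve need not be differentiable
  everywhere, even when run by arc length. The calibration therefore works on increments: after left
  translation each step of the curve starts at the identity, its \<open>t\<close>-part is quadratic
  in the length of the step, and errors of that order vanish under refinement. The inequality is
  proved for the scalar \<open>e \<bullet> t\<close> with a unit vector \<open>e\<close>. Motion of
  the projection along \<open>e\<close> costs length and gains no area, so the planar constant
  survives in three dimensions. On the kernel side, spherical coordinates are replaced by the image
  of Lebesgue measure under the pair (\<open>u \<bullet> l\<close>, \<open>norm l\<close>), whose
  density comes from areas of discs. A single polygamma value is never evaluated: the sine pairs the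
  frequencies \<open>\<tau>\<close> and \<open>- \<tau>\<close>, which correspond to
  \<open>z\<close> and \<open>1 - z\<close>, and it is this difference that reflection makes
  elementary. The resulting formula is exact, so the relative error is explicit.\<close>

text \<open>Stands in for the test by a nonpositive derivative. Over \<open>N\<close> equal pieces
  the increments add up to at most \<open>C * L^2 / N\<close>, which tends to 0.\<close>

lemma le_of_quadratic_increments:
  fixes f :: "real \<Rightarrow> real"
  assumes "0 \<le> L" and incr: "\<And>u v. 0 \<le> u \<Longrightarrow> u \<le> v \<Longrightarrow> v \<le> L \<Longrightarrow> f v - f u \<le> C * (v - u)\<^sup>2"
  shows "f L \<le> f 0"
proof -
  have "f L - f 0 \<le> C * L\<^sup>2 / real (Suc n)" for n
  proof -
    define N where "N = real (Suc n)"
    define p where "p i = real i * L / N" for i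
    have "N > 0" by (simp add: N_def)
    have p_mono: "p i \<le> p j" if "i \<le> j" for i j
      using that \<open>0 \<le> L\<close> \<open>N > 0\<close> by (auto simp: p_def intro!: divide_right_mono mult_right_mono)
    have p0: "p 0 = 0" and pL: "p (Suc n) = L"
      using \<open>N > 0\<close> by (simp_all add: p_def N_def del: of_nat_Suc)
    have step: "p (Suc i) - p i = L / N" for i
      by (simp add: p_def algebra_simps add_divide_distrib)
    have "f L - f 0 = (\<Sum>i<Suc n. f (p (Suc i)) - f (p i))"
      by (subst sum_lessThan_telescope) (simp add: p0 pL)
    also have "\<dots> \<le> (\<Sum>i<Suc n. C * (L / N)\<^sup>2)"
    proof (rule sum_mono)
      fix i assume "i \<in> {..<Suc n}"
      then have "0 \<le> p i" "p (Suc i) \<le> L"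
        using p_mono[of 0 i] p_mono[of "Suc i" "Suc n"] by (auto simp: p0 pL)
      then show "f (p (Suc i)) - f (p i) \<le> C * (L / N)\<^sup>2"
        using incr[of "p i" "p (Suc i)"] p_mono[of i "Suc i"] by (simp add: step)
    qed
    also have "\<dots> = N * (C * (L / N)\<^sup>2)"
      by (simp add: N_def)
    also have "\<dots> = C * L\<^sup>2 / N"
      using \<open>N > 0\<close> by (simp add: power2_eq_square)
    finally show ?thesis by (simp only: N_def)
  qed
  moreover have "(\<lambda>n. C * L\<^sup>2 / real (Suc n)) \<longlonglongrightarrow> 0"
    by (intro tendsto_divide_0[OF tendsto_const] filterlim_compose[OF filterlim_at_top_imp_at_infinity[OF filterlim_real_sequentially]]
      filterlim_Suc)
  ultimately have "f L - f 0 \<le> 0"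
    by (intro LIMSEQ_le_const) auto
  then show ?thesis by simp
qed

text \<open>The function \<open>\<phi>\<close> below is a calibration: with \<open>\<rho> = \<bar>x\<bar> / sin \<theta>\<close> its derivative along the
  curve is at most \<open>\<rho> / 2 - k \<rho>\<^sup>2 / 4 - 1 / (4 k) = - (k \<rho> - 1)\<^sup>2 / (4 k)\<close>.  The shift by
  \<open>\<delta>\<close> keeps \<open>\<theta>\<close> away from the poles of the cotangent.\<close>

lemma isoperimetric_unit_speed:
  fixes x :: "real \<Rightarrow> real^3" and A :: "real \<Rightarrow> real" and e :: "real^3"
  assumes e: "norm e = 1" and "0 \<le> L" and x0: "x 0 = 0" "x L = 0"
    and lip: "\<And>u v. 0 \<le> u \<Longrightarrow> u \<le> v \<Longrightarrow> v \<le> L \<Longrightarrow> norm (x v - x u) \<le> v - u"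
    and area: "\<And>u v. 0 \<le> u \<Longrightarrow> u \<le> v \<Longrightarrow> v \<le> L \<Longrightarrow>
      A v - A u + (1/2) * (e \<bullet> cross3 (x u) (x v - x u)) \<le> (v - u)\<^sup>2 / 2"
  shows "A L - A 0 \<le> L\<^sup>2 / (4 * pi)"
proof -
  have main: "A L - A 0 \<le> L * (L + 2 * \<delta>) / (4 * pi)" if "\<delta> > 0" for \<delta>
  proof -
    \<comment> \<open>With this \<open>k\<close> the angle \<open>\<theta>\<close> runs from
      \<open>k * \<delta>\<close> to \<open>pi - k * \<delta>\<close>. For
      \<open>\<delta> = 0\<close> the square of the calibration vanishes when
      \<open>norm (x q) = sin (k * q) / k\<close>, the chord cut off by an arc of length
      \<open>q\<close> on a circle of circumference \<open>L\<close>.\<close>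
    define k where "k = pi / (L + 2 * \<delta>)"
    define \<theta> where "\<theta> q = k * (q + \<delta>)" for q
    define \<phi> where "\<phi> q = A q + cot (\<theta> q) * (norm (x q))\<^sup>2 / 4 - q / (4 * k)" for q
    have "k > 0" using that \<open>0 \<le> L\<close> by (simp add: k_def)
    have sin_pos: "sin (\<theta> q) > 0" if "q \<in> {0..L}" for q
    proof (rule sin_gt_zero)
      show "0 < \<theta> q" using that \<open>k > 0\<close> \<open>\<delta> > 0\<close> by (simp add: \<theta>_def)
      have "\<theta> q < k * (L + 2 * \<delta>)"
        unfolding \<theta>_def using that \<open>k > 0\<close> \<open>\<delta> > 0\<close> by (intro mult_strict_left_mono) auto
      then show "\<theta> q < pi" using \<open>\<delta> > 0\<close> \<open>0 \<le> L\<close> by (simp add: k_def)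
    qed
    have "\<exists>q\<in>{0..L}. \<forall>p\<in>{0..L}. sin (\<theta> q) \<le> sin (\<theta> p)"
      unfolding \<theta>_def using \<open>0 \<le> L\<close> by (intro continuous_attains_inf continuous_intros) auto
    then obtain m where "m > 0" and m: "\<And>q. q \<in> {0..L} \<Longrightarrow> m \<le> sin (\<theta> q)"
      using sin_pos by blast
    \<comment> \<open>The four terms are the errors collected below: from the hypothesis
      \<open>area\<close>, from \<open>c' * (norm d)^2 / 4\<close>, from replacing
      \<open>sin (k * D)\<close> by \<open>k * D\<close>, and from replacing \<open>s * s'\<close>
      by \<open>s'^2\<close>.\<close>
    define C where "C = 1 / 2 + 1 / (4 * m) + k\<^sup>2 * L\<^sup>2 / (4 * m\<^sup>2) + k\<^sup>2 * L\<^sup>2 / (4 * m ^ 3)"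
    have "\<phi> v - \<phi> u \<le> C * (v - u)\<^sup>2" if uv: "0 \<le> u" "u \<le> v" "v \<le> L" for u v
    proof -
      define D where "D = v - u"
      define d where "d = x v - x u"
      define X where "X = x u"
      define s where "s = sin (\<theta> u)"
      define s' where "s' = sin (\<theta> v)"
      define c' where "c' = cot (\<theta> v)"
      define r where "r = norm X"
      have "D \<ge> 0" using uv by (simp add: D_def)
      have s: "m \<le> s" "0 < s" "m \<le> s'" "0 < s'"
        using uv m[of u] m[of v] \<open>m > 0\<close> by (auto simp: s_def s'_def)
      have d: "norm d \<le> D" using lip uv by (simp add: d_def D_def)
      have r: "0 \<le> r" "r \<le> L" using lip[of 0 u] uv x0 by (auto simp: r_def X_def)
      have xv: "x v = X + d" by (simp add: d_def X_def)
      have \<theta>: "\<theta> v - \<theta> u = k * D" by (simp add: \<theta>_def D_def algebra_simps)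

      have c'1: "1 + c'\<^sup>2 = 1 / s'\<^sup>2"
        using s sin_cos_squared_add[of "\<theta> v"] by (simp add: c'_def cot_def s'_def field_simps)
      have c'_le: "\<bar>c'\<bar> \<le> 1 / m"
      proof -
        have "\<bar>cos (\<theta> v)\<bar> / s' \<le> 1 / m"
          using s \<open>m > 0\<close> by (intro frac_le) auto
        then show ?thesis using s by (simp add: c'_def cot_def s'_def abs_divide)
      qed
      have cot_diff: "c' - cot (\<theta> u) = - sin (k * D) / (s * s')"
      proof -
        have "sin (k * D) = s' * cos (\<theta> u) - cos (\<theta> v) * s"
          unfolding \<theta>[symmetric] sin_diff s_def s'_def by simp
        then show ?thesis using s by (simp add: c'_def cot_def flip: s_def s'_def) (simp add: field_simps)
      qed
      have sin_le: "sin (k * D) \<le> k * D"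
        using \<open>k > 0\<close> \<open>D \<ge> 0\<close> by (intro sin_x_le_x) simp
      have sin_ge: "k * D - (k * D)\<^sup>2 / 2 \<le> sin (k * D)"
      proof -
        have "\<bar>sin (k * D) - k * D\<bar> \<le> (k * D)\<^sup>2 / 2"
          using Maclaurin_sin_bound[of "k * D" 2]
          by (simp add: numeral_2_eq_2 sin_coeff_def)
        then show ?thesis by linarith
      qed
      have s_diff: "\<bar>s' - s\<bar> \<le> k * D"
      proof -
        have "\<bar>s' - s\<bar> = 2 * \<bar>sin ((\<theta> v - \<theta> u) / 2)\<bar> * \<bar>cos ((\<theta> v + \<theta> u) / 2)\<bar>"
          unfolding s_def s'_def sin_diff_sin by (simp add: abs_mult)
        also have "\<dots> \<le> 2 * \<bar>(\<theta> v - \<theta> u) / 2\<bar> * 1"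
          by (intro mult_mono abs_sin_x_le_abs_x) auto
        finally show ?thesis using \<open>k > 0\<close> \<open>D \<ge> 0\<close> by (simp add: \<theta>)
      qed

      \<comment> \<open>The two linear terms form one inner product with \<open>d\<close>. Its other
        factor has orthogonal parts of norm at most \<open>r\<close> and equal to
        \<open>\<bar>c'\<bar> * r\<close>, and \<open>1 + cot^2 = 1 / sin^2\<close>. Here the
        component of \<open>X\<close> along \<open>e\<close> is discarded.\<close>
      have cross: "- (1/2) * (e \<bullet> cross3 X d) + c' * (X \<bullet> d) / 2 \<le> D * (r / s') / 2"
      proof -
        have "e \<bullet> cross3 X d = - (d \<bullet> cross3 X e)"
          by (simp add: cross3_simps)
        then have "- (1/2) * (e \<bullet> cross3 X d) + c' * (X \<bullet> d) / 2 = (d \<bullet> (cross3 X e + c' *\<^sub>R X)) / 2"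
          by (simp add: inner_add_right inner_commute)
        also have "\<dots> \<le> norm d * norm (cross3 X e + c' *\<^sub>R X) / 2"
          using norm_cauchy_schwarz by (intro divide_right_mono) auto
        also have "\<dots> \<le> D * (r / s') / 2"
        proof (intro divide_right_mono mult_mono)
          have "(norm (cross3 X e + c' *\<^sub>R X))\<^sup>2 = (norm (cross3 X e))\<^sup>2 + c'\<^sup>2 * r\<^sup>2"
            by (subst norm_add_Pythagorean) (auto simp: orthogonal_def dot_cross_self r_def power_mult_distrib)
          also have "\<dots> \<le> r\<^sup>2 + c'\<^sup>2 * r\<^sup>2"
          proof -
            have "(norm (cross3 X e))\<^sup>2 + (X \<bullet> e)\<^sup>2 = r\<^sup>2"
              using norm_cross_dot[of X e] e by (simp add: r_def)
            then show ?thesis using zero_le_power2[of "X \<bullet> e"] by linarith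
          qed
          also have "\<dots> = (r / s')\<^sup>2"
            using c'1 by (simp add: power_divide) (metis (no_types) distrib_right mult.left_neutral mult_1 times_divide_eq_left)
          finally show "norm (cross3 X e + c' *\<^sub>R X) \<le> r / s'"
            by (rule power2_le_imp_le) (use r s in simp)
        qed (use d \<open>D \<ge> 0\<close> in auto)
        finally show ?thesis .
      qed

      have quad: "(c' - cot (\<theta> u)) * r\<^sup>2 / 4 \<le> - k * D * (r / s')\<^sup>2 / 4 + (k\<^sup>2 * L\<^sup>2 / (4 * m\<^sup>2) + k\<^sup>2 * L\<^sup>2 / (4 * m ^ 3)) * D\<^sup>2"
      proof -
        have "1 / s'\<^sup>2 - 1 / (s * s') = (s - s') / (s * s'\<^sup>2)"
          using s by (simp add: field_simps power2_eq_square)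
        also have "\<dots> \<le> k * D / (m * m\<^sup>2)"
          using s s_diff \<open>m > 0\<close> \<open>k > 0\<close> \<open>D \<ge> 0\<close> by (intro frac_le mult_mono power_mono) auto
        finally have inv: "1 / s'\<^sup>2 \<le> 1 / (s * s') + k * D / m ^ 3"
          by (simp add: power3_eq_cube power2_eq_square)
        have r2: "r\<^sup>2 / (s * s') \<le> L\<^sup>2 / m\<^sup>2"
          unfolding power2_eq_square[of m] using s r \<open>m > 0\<close> by (intro frac_le mult_mono power_mono) auto
        have "k * D * (r / s')\<^sup>2 = k * D * r\<^sup>2 * (1 / s'\<^sup>2)"
          by (simp add: power_divide)
        also have "\<dots> \<le> k * D * r\<^sup>2 * (1 / (s * s') + k * D / m ^ 3)"
          using inv \<open>k > 0\<close> \<open>D \<ge> 0\<close> by (intro mult_left_mono) auto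
        also have "\<dots> = k * D * (r\<^sup>2 / (s * s')) + (k * D)\<^sup>2 / m ^ 3 * r\<^sup>2"
          by (simp add: algebra_simps power2_eq_square)
        also have "(k * D)\<^sup>2 / m ^ 3 * r\<^sup>2 \<le> (k * D)\<^sup>2 / m ^ 3 * L\<^sup>2"
          using r \<open>m > 0\<close> by (intro mult_left_mono power_mono) auto
        finally have 1: "k * D * (r / s')\<^sup>2 \<le> k * D * (r\<^sup>2 / (s * s')) + (k * D)\<^sup>2 / m ^ 3 * L\<^sup>2"
          by simp
        have "(k * D - sin (k * D)) * (r\<^sup>2 / (s * s')) \<le> ((k * D)\<^sup>2 / 2) * (L\<^sup>2 / m\<^sup>2)"
          using sin_le sin_ge r2 s by (intro mult_mono) auto
        also have "\<dots> \<le> (k * D)\<^sup>2 * (L\<^sup>2 / m\<^sup>2)"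
          by (intro mult_right_mono) auto
        finally have 2: "k * D * (r\<^sup>2 / (s * s')) \<le> sin (k * D) * (r\<^sup>2 / (s * s')) + (k * D)\<^sup>2 * (L\<^sup>2 / m\<^sup>2)"
          unfolding left_diff_distrib by linarith
        from 1 2 have "k * D * (r / s')\<^sup>2 \<le> sin (k * D) * (r\<^sup>2 / (s * s')) + (k * D)\<^sup>2 * (L\<^sup>2 / m\<^sup>2) + (k * D)\<^sup>2 / m ^ 3 * L\<^sup>2"
          by linarith
        then show ?thesis
          unfolding cot_diff by (simp add: power_mult_distrib algebra_simps)
      qed

      \<comment> \<open>An exact identity: half the triple product is added and subtracted, so that
        the first bracket is what \<open>area\<close> bounds and the second is what
        \<open>cross\<close> bounds.\<close>
      have "\<phi> v - \<phi> u = (A v - A u + (1/2) * (e \<bullet> cross3 X d)) + (- (1/2) * (e \<bullet> cross3 X d) + c' * (X \<bullet> d) / 2)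
          + (c' - cot (\<theta> u)) * r\<^sup>2 / 4 + c' * (norm d)\<^sup>2 / 4 - D / (4 * k)"
        unfolding \<phi>_def xv c'_def[symmetric] r_def X_def[symmetric] D_def
        by (simp add: power2_norm_eq_inner inner_add_left inner_add_right inner_commute
            algebra_simps add_divide_distrib diff_divide_distrib)
      also have "\<dots> \<le> D\<^sup>2 / 2 + D * (r / s') / 2 + (- k * D * (r / s')\<^sup>2 / 4 + (k\<^sup>2 * L\<^sup>2 / (4 * m\<^sup>2) + k\<^sup>2 * L\<^sup>2 / (4 * m ^ 3)) * D\<^sup>2)
          + D\<^sup>2 / (4 * m) - D / (4 * k)"
      proof -
        have "c' * (norm d)\<^sup>2 \<le> (1 / m) * D\<^sup>2"
          using c'_le d \<open>m > 0\<close> by (intro mult_mono power_mono) auto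
        moreover have "A v - A u + (1/2) * (e \<bullet> cross3 X d) \<le> D\<^sup>2 / 2"
          using area uv unfolding X_def d_def D_def by simp
        ultimately show ?thesis using cross quad by simp
      qed
      \<comment> \<open>Completing the square in \<open>r / s'\<close>; the main terms are
        nonpositive and only the quadratic error remains.\<close>
      also have "\<dots> = C * D\<^sup>2 - D * (k * (r / s') - 1)\<^sup>2 / (4 * k)"
      proof -
        have "D * \<rho> / 2 - k * D * \<rho>\<^sup>2 / 4 - D / (4 * k) = - (D * (k * \<rho> - 1)\<^sup>2 / (4 * k))" for \<rho>
          using \<open>k > 0\<close> by (simp add: power2_eq_square field_simps)
        from this[of "r / s'"]
        have "D * (r / s') / 2 + (- k * D * (r / s')\<^sup>2 / 4) - D / (4 * k) = - (D * (k * (r / s') - 1)\<^sup>2 / (4 * k))"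
          by simp
        moreover have "C * D\<^sup>2 = D\<^sup>2 / 2 + (k\<^sup>2 * L\<^sup>2 / (4 * m\<^sup>2) + k\<^sup>2 * L\<^sup>2 / (4 * m ^ 3)) * D\<^sup>2 + D\<^sup>2 / (4 * m)"
          unfolding C_def by (simp add: algebra_simps)
        ultimately show ?thesis by linarith
      qed
      also have "\<dots> \<le> C * D\<^sup>2"
        using \<open>k > 0\<close> \<open>D \<ge> 0\<close> by simp
      finally show ?thesis by (simp add: D_def)
    qed
    from le_of_quadratic_increments[OF \<open>0 \<le> L\<close> this] have "\<phi> L \<le> \<phi> 0" .
    \<comment> \<open>The cotangent terms drop out at both ends because the projected curve is
      closed at the origin.\<close>
    then have "A L - A 0 \<le> L / (4 * k)"
      by (simp add: \<phi>_def x0)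
    also have "\<dots> = L * (L + 2 * \<delta>) / (4 * pi)"
      using \<open>\<delta> > 0\<close> \<open>0 \<le> L\<close> by (simp add: k_def)
    finally show ?thesis .
  qed
  have "((\<lambda>\<delta>. L * (L + 2 * \<delta>) / (4 * pi)) \<longlongrightarrow> L * (L + 2 * 0) / (4 * pi)) (at_right 0)"
    by (intro tendsto_intros) auto
  then have "A L - A 0 \<le> L * (L + 2 * 0) / (4 * pi)"
    by (rule tendsto_lowerbound) (use main in \<open>auto simp: eventually_at_right_less intro!: eventually_mono[OF eventually_at_right_less[of 0]]\<close>)
  then show ?thesis by (simp add: power2_eq_square)
qed

section \<open>Horizontal curves: increments, arc length and the lower bound for the length\<close>

lemma horizontal_frame:
  "a $ 1 *\<^sub>R X1 g + a $ 2 *\<^sub>R X2 g + a $ 3 *\<^sub>R X3 g = (a, - (1/2) *\<^sub>R cross3 (fst g) a)"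
  by (simp add: X1_def X2_def X3_def cross3_def prod_eq_iff vec_eq_iff forall_3 field_simps)

lemma norm_cross3_le: "norm (cross3 a b) \<le> norm a * norm b"
proof (rule power2_le_imp_le)
  show "(norm (cross3 a b))\<^sup>2 \<le> (norm a * norm b)\<^sup>2"
    using norm_cross_dot[of a b] zero_le_power2[of "a \<bullet> b"] by linarith
qed simp

lemma norm_real3: "sqrt ((v $ 1)\<^sup>2 + (v $ 2)\<^sup>2 + (v $ 3)\<^sup>2) = norm (v :: real^3)"
  by (simp add: norm_vec_def L2_set_def sum_3)

lemma horizontal_length_norm: "horizontal_length a = integral {0..1} (\<lambda>s. norm (a s))"
  by (simp add: horizontal_length_def norm_real3)

text \<open>The defining integrals all start at 0; subtracting two of them localizes the equation to
  any subinterval, separately for the \<open>x\<close>- and \<open>t\<close>-components.\<close>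

lemma horizontal_curve_increment:
  assumes "horizontal_curve a \<gamma>" and uv: "0 \<le> u" "u \<le> v" "v \<le> 1"
  shows "(a has_integral (fst (\<gamma> v) - fst (\<gamma> u))) {u..v}"
    and "((\<lambda>s. - (1/2) *\<^sub>R cross3 (fst (\<gamma> s)) (a s)) has_integral (snd (\<gamma> v) - snd (\<gamma> u))) {u..v}"
proof -
  define F where "F = (\<lambda>s. (a s, - (1/2) *\<^sub>R cross3 (fst (\<gamma> s)) (a s)))"
  have F: "(F has_integral (\<gamma> s - \<gamma> 0)) {0..s}" if "s \<in> {0..1}" for s
    using assms(1) that unfolding horizontal_curve_def horizontal_frame F_def by blast
  have "F integrable_on {0..v}" using F[of v] uv by (auto simp: integrable_on_def)
  then have "integral {0..u} F + integral {u..v} F = integral {0..v} F" and "F integrable_on {u..v}"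
    using uv by (auto intro: Henstock_Kurzweil_Integration.integral_combine integrable_on_subinterval)
  moreover have "integral {0..u} F = \<gamma> u - \<gamma> 0" "integral {0..v} F = \<gamma> v - \<gamma> 0"
    using F[of u] F[of v] uv by (auto intro: integral_unique)
  ultimately have "integral {u..v} F = \<gamma> v - \<gamma> u" "(F has_integral integral {u..v} F) {u..v}"
    by (auto simp: algebra_simps has_integral_integral)
  then have "(F has_integral (\<gamma> v - \<gamma> u)) {u..v}"
    by simp
  from has_integral_linear[OF this bounded_linear_fst] has_integral_linear[OF this bounded_linear_snd]
  show "(a has_integral (fst (\<gamma> v) - fst (\<gamma> u))) {u..v}"
    and "((\<lambda>s. - (1/2) *\<^sub>R cross3 (fst (\<gamma> s)) (a s)) has_integral (snd (\<gamma> v) - snd (\<gamma> u))) {u..v}"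
    by (simp_all add: F_def o_def)
qed

text \<open>Parametrising the curve by arc length makes it 1-Lipschitz; no differentiability is needed,
  only these increment bounds.\<close>

lemma horizontal_curve_increment_le:
  assumes hc: "horizontal_curve a \<gamma>" and uv: "0 \<le> u" "u \<le> v" "v \<le> 1"
  defines "\<sigma> \<equiv> \<lambda>s. integral {0..s} (\<lambda>s. norm (a s))"
  shows "norm (fst (\<gamma> v) - fst (\<gamma> u)) \<le> \<sigma> v - \<sigma> u"
    and "norm (snd (\<gamma> v) - snd (\<gamma> u) + (1/2) *\<^sub>R cross3 (fst (\<gamma> u)) (fst (\<gamma> v) - fst (\<gamma> u))) \<le> (\<sigma> v - \<sigma> u)\<^sup>2 / 2"
proof -
  have "a absolutely_integrable_on {0..1}"
    using hc by (simp add: horizontal_curve_def)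
  then have int: "(\<lambda>s. norm (a s)) integrable_on {0..1}"
    by (simp add: absolutely_integrable_on_def)
  have int_sub: "(\<lambda>s. norm (a s)) integrable_on {p..q}" if "0 \<le> p" "q \<le> 1" for p q
    using that by (intro integrable_on_subinterval[OF int]) auto
  have \<sigma>: "integral {p..q} (\<lambda>s. norm (a s)) = \<sigma> q - \<sigma> p" if "0 \<le> p" "p \<le> q" "q \<le> 1" for p q
    using Henstock_Kurzweil_Integration.integral_combine[OF that(1,2) int_sub[of 0 q]] that by (simp add: \<sigma>_def)
  have lip: "norm (fst (\<gamma> q) - fst (\<gamma> p)) \<le> \<sigma> q - \<sigma> p" if "0 \<le> p" "p \<le> q" "q \<le> 1" for p q
    unfolding \<sigma>[OF that, symmetric] integral_unique[OF horizontal_curve_increment(1)[OF hc that], symmetric]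
    using that by (intro integral_norm_bound_integral int_sub has_integral_integrable[OF horizontal_curve_increment(1)[OF hc]]) auto
  have \<sigma>_mono: "\<sigma> p \<le> \<sigma> q" if "0 \<le> p" "p \<le> q" "q \<le> 1" for p q
    using lip[OF that] norm_ge_zero[of "fst (\<gamma> q) - fst (\<gamma> p)"] by linarith
  show "norm (fst (\<gamma> v) - fst (\<gamma> u)) \<le> \<sigma> v - \<sigma> u"
    by (rule lip[OF uv])
  \<comment> \<open>Adding this to the \<open>t\<close>-increment gives the
    \<open>t\<close>-component of the inverse of \<open>\<gamma> u\<close> times
    \<open>\<gamma> v\<close>. The integrand then contains
    \<open>fst (\<gamma> s) - fst (\<gamma> u)\<close> instead of \<open>fst (\<gamma> s)\<close>,
    which is what makes the bound quadratic.\<close>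
  have "((\<lambda>s. (1/2) *\<^sub>R cross3 (fst (\<gamma> u)) (a s)) has_integral (1/2) *\<^sub>R cross3 (fst (\<gamma> u)) (fst (\<gamma> v) - fst (\<gamma> u))) {u..v}"
  proof -
    have "linear (\<lambda>y. (1/2) *\<^sub>R cross3 (fst (\<gamma> u)) y)"
      by (rule linearI) (simp_all add: cross_add_right cross_mult_right scaleR_add_right)
    then have "bounded_linear (\<lambda>y. (1/2) *\<^sub>R cross3 (fst (\<gamma> u)) y)"
      by (simp add: linear_conv_bounded_linear)
    from has_integral_linear[OF horizontal_curve_increment(1)[OF hc uv] this] show ?thesis
      by (simp add: o_def)
  qed
  from has_integral_add[OF horizontal_curve_increment(2)[OF hc uv] this]
  have *: "((\<lambda>s. - (1/2) *\<^sub>R cross3 (fst (\<gamma> s) - fst (\<gamma> u)) (a s)) has_integral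
    (snd (\<gamma> v) - snd (\<gamma> u) + (1/2) *\<^sub>R cross3 (fst (\<gamma> u)) (fst (\<gamma> v) - fst (\<gamma> u)))) {u..v}"
    by (simp add: Cross3.left_diff_distrib scaleR_diff_right)
  have "norm (integral {u..v} (\<lambda>s. - (1/2) *\<^sub>R cross3 (fst (\<gamma> s) - fst (\<gamma> u)) (a s)))
    \<le> integral {u..v} (\<lambda>s. (\<sigma> v - \<sigma> u) / 2 * norm (a s))"
  proof (rule integral_norm_bound_integral)
    show "(\<lambda>s. - (1/2) *\<^sub>R cross3 (fst (\<gamma> s) - fst (\<gamma> u)) (a s)) integrable_on {u..v}"
      using * by (rule has_integral_integrable)
    show "(\<lambda>s. (\<sigma> v - \<sigma> u) / 2 * norm (a s)) integrable_on {u..v}"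
      using int_sub[of u v] uv by (intro integrable_on_mult_right) auto
    fix s assume s: "s \<in> {u..v}"
    then have "norm (fst (\<gamma> s) - fst (\<gamma> u)) \<le> \<sigma> v - \<sigma> u"
      using lip[of u s] \<sigma>_mono[of s v] uv by auto
    then have "norm (cross3 (fst (\<gamma> s) - fst (\<gamma> u)) (a s)) \<le> (\<sigma> v - \<sigma> u) * norm (a s)"
      by (intro order.trans[OF norm_cross3_le] mult_right_mono) auto
    then show "norm (- (1/2) *\<^sub>R cross3 (fst (\<gamma> s) - fst (\<gamma> u)) (a s)) \<le> (\<sigma> v - \<sigma> u) / 2 * norm (a s)"
      by simp
  qed
  also have "\<dots> = (\<sigma> v - \<sigma> u)\<^sup>2 / 2"
    by (simp add: \<sigma>[OF uv] power2_eq_square)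
  finally show "norm (snd (\<gamma> v) - snd (\<gamma> u) + (1/2) *\<^sub>R cross3 (fst (\<gamma> u)) (fst (\<gamma> v) - fst (\<gamma> u))) \<le> (\<sigma> v - \<sigma> u)\<^sup>2 / 2"
    unfolding integral_unique[OF *] .
qed

text \<open>Arc length \<open>\<sigma>\<close> is only nondecreasing and may lack an inverse. A
  monotone right inverse \<open>h\<close> suffices, since increments of the curve are controlled by
  increments of \<open>\<sigma>\<close> alone.\<close>

lemma horizontal_length_vertical_ge:
  assumes hc: "horizontal_curve a \<gamma>" and \<gamma>0: "\<gamma> 0 = (0, 0)" and \<gamma>1: "\<gamma> 1 = (0, t)"
  shows "sqrt (4 * pi * norm t) \<le> horizontal_length a"
proof -
  define \<sigma> where "\<sigma> s = integral {0..s} (\<lambda>s. norm (a s))" for s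
  define L where "L = horizontal_length a"
  note incr = horizontal_curve_increment_le[OF hc, folded \<sigma>_def]
  have \<sigma>0: "\<sigma> 0 = 0" and \<sigma>1: "\<sigma> 1 = L"
    by (simp_all add: \<sigma>_def L_def horizontal_length_norm)
  have \<sigma>_mono: "\<sigma> p \<le> \<sigma> q" if "0 \<le> p" "p \<le> q" "q \<le> 1" for p q
    using incr(1)[OF that] norm_ge_zero[of "fst (\<gamma> q) - fst (\<gamma> p)"] by linarith
  have "L \<ge> 0" using \<sigma>_mono[of 0 1] \<sigma>0 \<sigma>1 by simp
  have "norm t \<le> L\<^sup>2 / (4 * pi)"
  \<comment> \<open>For \<open>L = 0\<close> the parameters of the two endpoints would coincide, and
    for \<open>t = 0\<close> there is no direction \<open>e\<close>; both cases follow from the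
    increment bound over the whole curve.\<close>
  proof (cases "L = 0 \<or> t = 0")
    case True
    then show ?thesis using incr(2)[of 0 1] \<gamma>0 \<gamma>1 \<sigma>0 \<sigma>1 by auto
  next
    case False
    then have "L > 0" "t \<noteq> 0" using \<open>L \<ge> 0\<close> by auto
    have "continuous_on {0..1} \<sigma>"
      unfolding \<sigma>_def using hc
      by (intro indefinite_integral_continuous_1) (auto simp: horizontal_curve_def absolutely_integrable_on_def)
    then have "\<exists>s. 0 \<le> s \<and> s \<le> 1 \<and> \<sigma> s = q" if "q \<in> {0..L}" for q
      using that \<sigma>0 \<sigma>1 by (intro IVT') auto
    then obtain g where g: "\<And>q. q \<in> {0..L} \<Longrightarrow> 0 \<le> g q \<and> g q \<le> 1 \<and> \<sigma> (g q) = q"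
      by metis
    \<comment> \<open>The intermediate value theorem may pick any preimage; the values at 0 and
      \<open>L\<close> are prescribed so that the reparametrised curve keeps the endpoints
      \<open>\<gamma> 0\<close> and \<open>\<gamma> 1\<close>.\<close>
    define h where "h q = (if q = 0 then 0 else if q = L then 1 else g q)" for q
    have h: "0 \<le> h q" "h q \<le> 1" "\<sigma> (h q) = q" if "0 \<le> q" "q \<le> L" for q
      using g[of q] that \<sigma>0 \<sigma>1 by (auto simp: h_def)
    have h_mono: "h u \<le> h v" if "0 \<le> u" "u \<le> v" "v \<le> L" for u v
    proof (rule ccontr)
      assume "\<not> h u \<le> h v"
      then have "\<sigma> (h v) \<le> \<sigma> (h u)" using that by (intro \<sigma>_mono h) auto
      then have "u = v" using h that by simp
      then show False using \<open>\<not> h u \<le> h v\<close> by simp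
    qed
    define e where "e = sgn t"
    have e: "norm e = 1" "e \<bullet> t = norm t"
      using \<open>t \<noteq> 0\<close> by (simp_all add: e_def norm_sgn sgn_div_norm dot_square_norm power2_eq_square)
    have "e \<bullet> snd (\<gamma> (h L)) - e \<bullet> snd (\<gamma> (h 0)) \<le> L\<^sup>2 / (4 * pi)"
    proof (rule isoperimetric_unit_speed[where x = "\<lambda>q. fst (\<gamma> (h q))", OF e(1) \<open>L \<ge> 0\<close>])
      show "fst (\<gamma> (h 0)) = 0" "fst (\<gamma> (h L)) = 0"
        using \<open>L > 0\<close> \<gamma>0 \<gamma>1 by (simp_all add: h_def)
      fix u v assume uv: "0 \<le> u" "u \<le> v" "v \<le> L"
      then have *: "0 \<le> h u" "h u \<le> h v" "h v \<le> 1" "\<sigma> (h v) - \<sigma> (h u) = v - u"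
        using h[of u] h[of v] h_mono[OF uv] by auto
      show "norm (fst (\<gamma> (h v)) - fst (\<gamma> (h u))) \<le> v - u"
        using incr(1)[OF *(1-3)] *(4) by simp
      let ?w = "snd (\<gamma> (h v)) - snd (\<gamma> (h u)) + (1/2) *\<^sub>R cross3 (fst (\<gamma> (h u))) (fst (\<gamma> (h v)) - fst (\<gamma> (h u)))"
      have "e \<bullet> ?w \<le> norm ?w"
        using norm_cauchy_schwarz[of e ?w] e(1) by simp
      also have "\<dots> \<le> (v - u)\<^sup>2 / 2"
        using incr(2)[OF *(1-3)] *(4) by simp
      finally show "e \<bullet> snd (\<gamma> (h v)) - e \<bullet> snd (\<gamma> (h u)) + (1/2) * (e \<bullet> cross3 (fst (\<gamma> (h u))) (fst (\<gamma> (h v)) - fst (\<gamma> (h u))))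
          \<le> (v - u)\<^sup>2 / 2"
        by (simp add: inner_add_right inner_diff_right)
    qed
    then show ?thesis using \<open>L > 0\<close> \<gamma>0 \<gamma>1 e(2) by (simp add: h_def)
  qed
  then have "4 * pi * norm t \<le> L\<^sup>2" by (simp add: field_simps)
  then show ?thesis using \<open>L \<ge> 0\<close> unfolding L_def by (simp add: real_le_lsqrt)
qed

section \<open>The minimizing circle\<close>

text \<open>A circle of circumference \<open>L\<close> encloses area \<open>L^2 / (4 * pi)\<close>.
  Running once, at constant speed, around such a circle through the origin in a plane orthogonal to
  \<open>t\<close> produces exactly \<open>t\<close> when \<open>L^2 = 4 * pi * norm t\<close>; for
  \<open>t = 0\<close> the curve is constant.\<close>

lemma ex_horizontal_circle:
  fixes t :: "real^3"
  shows "\<exists>a \<gamma>. horizontal_curve a \<gamma> \<and> \<gamma> 0 = (0, 0) \<and> \<gamma> 1 = (0, t) \<and> horizontal_length a = sqrt (4 * pi * norm t)"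
proof -
  define L where "L = sqrt (4 * pi * norm t)"
  have L2: "L\<^sup>2 = 4 * pi * norm t" by (simp add: L_def)
  \<comment> \<open>Sending the third axis to \<open>- t\<close> offsets the minus sign in the
    equation for the \<open>t\<close>-component. Determinant 1 lets \<open>T\<close> commute with
    the cross product, so the images of the first two axes span the required oriented plane.\<close>
  obtain T :: "real^3 \<Rightarrow> real^3" where T: "orthogonal_transformation T" "det (matrix T) = 1" "T (norm t *\<^sub>R axis 3 1) = - t"
  proof (rule rotation_exists[of "norm t *\<^sub>R axis 3 1" "- t"])
    show "2 \<le> CARD(3)" by simp
    show "norm (norm t *\<^sub>R axis 3 1 :: real^3) = norm (- t)" by simp
  qed auto
  define p where "p = T (axis 1 1)"
  define q where "q = T (axis 2 1)"
  have Tlin: "linear T" using T(1) by (rule orthogonal_transformation_linear)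
  have pq: "norm t *\<^sub>R cross3 p q = - t"
  proof -
    have "cross3 p q = T (axis 3 1)"
      using cross_orthogonal_transformation[OF T(1), of "axis 1 1" "axis 2 1"] T(2)
      by (simp add: p_def q_def cross_basis)
    then have "norm t *\<^sub>R cross3 p q = T (norm t *\<^sub>R axis 3 1)"
      using Tlin by (simp add: linear_scale)
    then show ?thesis using T(3) by simp
  qed
  have orth: "p \<bullet> p = 1" "q \<bullet> q = 1" "p \<bullet> q = 0"
    using T(1) unfolding p_def q_def orthogonal_transformation_def by (simp_all add: inner_axis_axis)
  define a where "a s = L *\<^sub>R (cos (2 * pi * s) *\<^sub>R p + sin (2 * pi * s) *\<^sub>R q)" for s
  define x where "x s = (L / (2 * pi)) *\<^sub>R (sin (2 * pi * s) *\<^sub>R p + (1 - cos (2 * pi * s)) *\<^sub>R q)" for s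
  \<comment> \<open>The \<open>t\<close>-component is the antiderivative of
    \<open>1 - cos (2 * pi * s)\<close>, the factor found in \<open>cross\<close> below.\<close>
  define \<gamma> where "\<gamma> s = (x s, (s - sin (2 * pi * s) / (2 * pi)) *\<^sub>R t)" for s
  have norm_a: "norm (a s) = L" for s
  proof -
    have "(norm (L *\<^sub>R (c *\<^sub>R p + d *\<^sub>R q)))\<^sup>2 = L\<^sup>2 * (c\<^sup>2 + d\<^sup>2)" for c d
      unfolding power2_norm_eq_inner using orth
      by (simp add: inner_add_left inner_add_right inner_commute[of q p] power2_eq_square algebra_simps)
    then have "(norm (a s))\<^sup>2 = L\<^sup>2"
      by (simp add: a_def)
    then show ?thesis by (rule power2_eq_imp_eq) (simp_all add: L_def)
  qed
  have cross: "- (1/2) *\<^sub>R cross3 (x s) (a s) = (1 - cos (2 * pi * s)) *\<^sub>R t" for s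
  proof -
    let ?c = "cos (2 * pi * s)" and ?s = "sin (2 * pi * s)"
    have "cross3 (\<mu> *\<^sub>R (d *\<^sub>R p + b *\<^sub>R q)) (\<nu> *\<^sub>R (c *\<^sub>R p + d *\<^sub>R q))
        = (\<mu> * \<nu> * (d * d - b * c)) *\<^sub>R cross3 p q" for \<mu> \<nu> b c d
      by (simp add: cross_add_left cross_add_right cross_mult_left cross_mult_right cross_skew[of q p] algebra_simps)
    then have "cross3 (x s) (a s) = (L\<^sup>2 / (2 * pi) * (?s * ?s - (1 - ?c) * ?c)) *\<^sub>R cross3 p q"
      unfolding x_def a_def by (simp add: power2_eq_square)
    also have "?s * ?s - (1 - ?c) * ?c = 1 - ?c"
      using sin_cos_squared_add[of "2 * pi * s"] by (simp add: power2_eq_square algebra_simps)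
    also have "(L\<^sup>2 / (2 * pi) * (1 - ?c)) *\<^sub>R cross3 p q = (2 * (1 - ?c)) *\<^sub>R (norm t *\<^sub>R cross3 p q)"
      by (simp add: L2)
    finally show ?thesis by (simp add: pq)
  qed
  have deriv: "(\<gamma> has_vector_derivative (a s, - (1/2) *\<^sub>R cross3 (x s) (a s))) (at s within S)" for s S
    unfolding cross unfolding \<gamma>_def x_def a_def
    by (auto intro!: derivative_eq_intros has_vector_derivative_Pair simp: algebra_simps)
  have "horizontal_curve a \<gamma>"
    unfolding horizontal_curve_def horizontal_frame
  proof (intro conjI ballI)
    show "continuous_on {0..1} \<gamma>"
      unfolding \<gamma>_def x_def by (intro continuous_intros) auto
    have "continuous_on {0..1} a"
      unfolding a_def by (intro continuous_intros)
    then show "a absolutely_integrable_on {0..1}"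
      by (rule absolutely_integrable_continuous_real)
    fix s :: real assume "s \<in> {0..1}"
    then have "((\<lambda>s. (a s, - (1/2) *\<^sub>R cross3 (x s) (a s))) has_integral (\<gamma> s - \<gamma> 0)) {0..s}"
      by (intro fundamental_theorem_of_calculus deriv) auto
    then show "((\<lambda>u. (a u, - (1/2) *\<^sub>R cross3 (fst (\<gamma> u)) (a u))) has_integral (\<gamma> s - \<gamma> 0)) {0..s}"
      by (simp add: \<gamma>_def)
  qed
  moreover have "\<gamma> 0 = (0, 0)" "\<gamma> 1 = (0, t)" by (simp_all add: \<gamma>_def x_def)
  moreover have "horizontal_length a = L" by (simp add: horizontal_length_norm norm_a)
  ultimately show ?thesis unfolding L_def by blast
qed

lemma cc_dist_vertical: "cc_dist (0, t) = sqrt (4 * pi * norm t)"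
  unfolding cc_dist_def
proof (rule cInf_eq_minimum)
  show "sqrt (4 * pi * norm t) \<in> {horizontal_length a | a \<gamma>. horizontal_curve a \<gamma> \<and> \<gamma> 0 = (0, 0) \<and> \<gamma> 1 = (0, t)}"
    using ex_horizontal_circle[of t] by (auto simp: eq_commute)
qed (auto intro: horizontal_length_vertical_ge)

section \<open>Fourier transform of radial functions\<close>

text \<open>Invariance of Lebesgue measure under rotations, in the form of an image measure, so that
  the direction of \<open>t\<close> can later be moved to a coordinate axis.\<close>

lemma distr_lborel_orthogonal_transformation:
  fixes T :: "real^'n::{finite, wellorder} \<Rightarrow> real^'n::_"
  assumes "orthogonal_transformation T"
  shows "distr lborel borel T = lborel"
proof (rule lborel_eqI[symmetric])
  have T: "T \<in> borel_measurable borel"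
    using assms by (intro borel_measurable_continuous_onI linear_continuous_on)
      (simp add: linear_linear orthogonal_transformation_linear)
  fix l u :: "real^'n::_"
  assume lu: "\<And>b. b \<in> Basis \<Longrightarrow> l \<bullet> b \<le> u \<bullet> b"
  have inv: "orthogonal_transformation (inv T)"
    by (rule orthogonal_transformation_inv[OF assms])
  have vim: "T -` box l u = inv T ` box l u"
    using orthogonal_transformation_bij[OF assms] by (simp add: bij_vimage_eq_inv_image)
  have "inv T ` box l u \<in> lmeasurable"
    by (rule measurable_orthogonal_image[OF inv]) simp
  moreover have "measure lebesgue (inv T ` box l u) = measure lebesgue (box l u)"
    by (rule measure_orthogonal_image[OF inv]) simp
  ultimately have "emeasure lebesgue (T -` box l u) = emeasure lebesgue (box l u)"
    unfolding vim by (simp add: emeasure_eq_measure2)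
  moreover have "T -` box l u \<in> sets borel"
    using measurable_sets[OF T, of "box l u"] by simp
  ultimately have "emeasure lborel (T -` box l u) = emeasure lborel (box l u)"
    by simp
  then show "emeasure (distr lborel borel T) (box l u) = (\<Prod>b\<in>Basis. (u - l) \<bullet> b)"
    using T lu by (simp add: emeasure_distr emeasure_lborel_box)
qed simp

text \<open>Splits space into an axis and a plane modelled by the complex numbers. The plane will
  enter only through the modulus, so that areas of discs are all that is required of it.\<close>

lemma distr_lborel_real_complex:
  "distr (lborel \<Otimes>\<^sub>M lborel) borel (\<lambda>(y :: real, z). vector [y, Re z, Im z]) = (lborel :: (real^3) measure)"
proof (rule lborel_eqI[symmetric])
  define P :: "real \<times> complex \<Rightarrow> real^3" where "P = (\<lambda>(y, z). vector [y, Re z, Im z])"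
  have "linear P"
    unfolding P_def by (rule linearI) (auto simp: vec_eq_iff forall_3)
  then have P[measurable]: "P \<in> borel_measurable borel"
    by (intro borel_measurable_continuous_onI linear_continuous_on)
      (simp add: linear_linear)
  fix l u :: "real^3"
  assume lu: "\<And>b. b \<in> Basis \<Longrightarrow> l \<bullet> b \<le> u \<bullet> b"
  have le: "l $ i \<le> u $ i" for i
    using lu[of "axis i 1"] by (simp add: inner_axis)
  have *: "P -` box l u = box (l $ 1) (u $ 1) \<times> box (Complex (l $ 2) (l $ 3)) (Complex (u $ 2) (u $ 3))"
    by (auto simp: P_def box_def Basis_complex_def Basis_vec_def inner_axis forall_3)
  have "emeasure (distr (lborel \<Otimes>\<^sub>M lborel) borel P) (box l u)
      = emeasure (lborel \<Otimes>\<^sub>M lborel) (box (l $ 1) (u $ 1) \<times> box (Complex (l $ 2) (l $ 3)) (Complex (u $ 2) (u $ 3)))"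
    by (subst emeasure_distr) (auto simp: lborel_prod space_pair_measure *)
  also have "\<dots> = ennreal (u $ 1 - l $ 1) * ennreal ((u $ 2 - l $ 2) * (u $ 3 - l $ 3))"
    using le by (subst lborel.emeasure_pair_measure_Times)
      (simp_all add: emeasure_lborel_box_eq Basis_complex_def inner_complex_def)
  also have "\<dots> = (\<Prod>b\<in>Basis. (u - l) \<bullet> b)"
  proof -
    have "(\<Prod>b\<in>Basis. (u - l) \<bullet> b) = (\<Prod>i\<in>UNIV. u $ i - l $ i)"
      by (simp add: Basis_vec_def axis_eq_axis prod.UNION_disjoint inner_axis)
    also have "\<dots> = (u $ 1 - l $ 1) * ((u $ 2 - l $ 2) * (u $ 3 - l $ 3))"
      unfolding UNIV_3 by (simp add: mult.assoc)
    finally show ?thesis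
      using le[of 1] by (simp only: ennreal_mult' diff_ge_0_iff_ge)
  qed
  finally show "emeasure (distr (lborel \<Otimes>\<^sub>M lborel) borel (\<lambda>(y :: real, z). vector [y, Re z, Im z])) (box l u) = (\<Prod>b\<in>Basis. (u - l) \<bullet> b)"
    unfolding P_def .
qed simp

text \<open>In the slice at height \<open>y\<close>, the points of norm below \<open>R\<close> form
  a disc of area \<open>pi * (R^2 - y^2)\<close>, whose derivative in \<open>R\<close> is
  \<open>2 * pi * R\<close>.\<close>

lemma distr_lborel_slice:
  fixes y :: real
  shows "distr lborel borel (\<lambda>z::complex. sqrt (y\<^sup>2 + (norm z)\<^sup>2))
    = density lborel (\<lambda>r. ennreal (if \<bar>y\<bar> \<le> r then 2 * pi * r else 0))" (is "?M = ?N")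
proof -
  \<comment> \<open>The comparison of measures is made on right half-lines and asks for finite
    values. Negation turns these half-lines into bounded discs; without it they would have infinite
    measure.\<close>
  have "distr ?M borel uminus = distr ?N borel uminus"
  proof (rule measure_eqI_lessThan)
    fix x :: real
    have 1: "emeasure (distr ?M borel uminus) {x<..} = ennreal (if x < - \<bar>y\<bar> then pi * (x\<^sup>2 - y\<^sup>2) else 0)"
    proof -
      have "emeasure (distr ?M borel uminus) {x<..} = emeasure lborel {z::complex. sqrt (y\<^sup>2 + (norm z)\<^sup>2) < - x}"
        by (subst distr_distr) (auto simp: emeasure_distr comp_def vimage_def less_minus_iff)
      also have "{z::complex. sqrt (y\<^sup>2 + (norm z)\<^sup>2) < - x} = (if x < - \<bar>y\<bar> then ball 0 (sqrt (x\<^sup>2 - y\<^sup>2)) else {})"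
      proof (cases "x < - \<bar>y\<bar>")
        case True
        then have "y\<^sup>2 \<le> x\<^sup>2" by (simp add: abs_le_square_iff[symmetric])
        have "sqrt (y\<^sup>2 + (norm z)\<^sup>2) < - x \<longleftrightarrow> norm z < sqrt (x\<^sup>2 - y\<^sup>2)" for z :: complex
        proof -
          have "sqrt (y\<^sup>2 + (norm z)\<^sup>2) < - x \<longleftrightarrow> sqrt (y\<^sup>2 + (norm z)\<^sup>2) < sqrt (x\<^sup>2)"
            using True by simp
          also have "\<dots> \<longleftrightarrow> (norm z)\<^sup>2 < x\<^sup>2 - y\<^sup>2" unfolding real_sqrt_less_iff by auto
          also have "\<dots> \<longleftrightarrow> sqrt ((norm z)\<^sup>2) < sqrt (x\<^sup>2 - y\<^sup>2)" by (subst real_sqrt_less_iff) simp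
          finally show ?thesis by simp
        qed
        then show ?thesis using True by (simp only: ball_def dist_0_norm if_True)
      next
        case False
        have "\<bar>y\<bar> \<le> sqrt (y\<^sup>2 + (norm z)\<^sup>2)" for z :: complex
          by (rule real_le_rsqrt) simp
        then have "\<not> sqrt (y\<^sup>2 + (norm z)\<^sup>2) < - x" for z :: complex
          using False by (smt (verit))
        then show ?thesis using False by simp
      qed
      also have "emeasure lborel \<dots> = ennreal (if x < - \<bar>y\<bar> then pi * (x\<^sup>2 - y\<^sup>2) else 0)"
      proof (cases "x < - \<bar>y\<bar>")
        case True
        then have "y\<^sup>2 \<le> x\<^sup>2" by (simp add: abs_le_square_iff[symmetric])
        then show ?thesis using True by (simp add: emeasure_ball unit_ball_vol_2 DIM_complex)
      qed simp
      finally show ?thesis .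
    qed
    have 2: "emeasure (distr ?N borel uminus) {x<..} = ennreal (if x < - \<bar>y\<bar> then pi * (x\<^sup>2 - y\<^sup>2) else 0)"
    proof -
      have "emeasure (distr ?N borel uminus) {x<..} = emeasure ?N {..<-x}"
        by (subst emeasure_distr) (auto simp: vimage_def less_minus_iff lessThan_def)
      also have "\<dots> = (\<integral>\<^sup>+ r. ennreal (2 * pi * r) * indicator {\<bar>y\<bar>..<-x} r \<partial>lborel)"
        by (subst emeasure_density) (auto intro!: nn_integral_cong simp: indicator_def)
      also have "\<dots> = (\<integral>\<^sup>+ r. ennreal (2 * pi * r) * indicator {\<bar>y\<bar>..-x} r \<partial>lborel)"
        by (intro nn_integral_cong_AE eventually_mono[OF AE_lborel_singleton[of "-x"]])
          (auto simp: indicator_def)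
      also have "\<dots> = ennreal (if x < - \<bar>y\<bar> then pi * (x\<^sup>2 - y\<^sup>2) else 0)"
      proof (cases "x < - \<bar>y\<bar>")
        case True
        have "(\<integral>\<^sup>+ r. ennreal (2 * pi * r) * indicator {\<bar>y\<bar>..-x} r \<partial>lborel) = ennreal (pi * (-x)\<^sup>2 - pi * \<bar>y\<bar>\<^sup>2)"
          using True by (intro nn_integral_FTC_Icc[where F="\<lambda>r. pi * r\<^sup>2"]) (auto intro!: derivative_eq_intros)
        then show ?thesis using True by (simp add: right_diff_distrib)
      next
        case False
        have "AE r in lborel. ennreal (2 * pi * r) * indicator {\<bar>y\<bar>..-x} r = 0"
          using AE_lborel_singleton[of "-x"] by eventually_elim (use False in \<open>auto simp: indicator_def\<close>)
        then have "(\<integral>\<^sup>+ r. ennreal (2 * pi * r) * indicator {\<bar>y\<bar>..-x} r \<partial>lborel) = 0"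
          by (subst nn_integral_0_iff_AE) auto
        then show ?thesis using False by simp
      qed
      finally show ?thesis .
    qed
    show "emeasure (distr ?M borel uminus) {x<..} < \<infinity>" unfolding 1 by simp
    show "emeasure (distr ?M borel uminus) {x<..} = emeasure (distr ?N borel uminus) {x<..}"
      unfolding 1 2 ..
  qed simp_all
  then have "distr (distr ?M borel uminus) borel uminus = distr (distr ?N borel uminus) borel uminus"
    by simp
  moreover have "distr (distr ?N borel uminus) borel uminus = ?N"
    by (subst distr_distr) (auto simp: comp_def intro!: distr_id2)
  moreover have "distr (distr ?M borel uminus) borel uminus = ?M"
    by (subst distr_distr) (auto simp: comp_def intro!: distr_id2)
  ultimately show ?thesis by simp
qed

lemma measurable_cone_weight:
  "(\<lambda>(y :: real, r). if \<bar>y\<bar> \<le> r then 2 * pi * r else 0) \<in> borel_measurable (borel \<Otimes>\<^sub>M borel)"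
proof -
  have "closed {p :: real \<times> real. \<bar>fst p\<bar> \<le> snd p}"
    by (intro closed_Collect_le continuous_intros)
  then have "{p \<in> space borel. \<bar>fst p\<bar> \<le> snd p} \<in> sets (borel :: (real \<times> real) measure)"
    by (simp add: borel_closed)
  moreover have "(\<lambda>p :: real \<times> real. 2 * pi * snd p) \<in> borel_measurable borel"
    by (intro borel_measurable_continuous_onI continuous_intros)
  ultimately have "(\<lambda>p :: real \<times> real. if \<bar>fst p\<bar> \<le> snd p then 2 * pi * snd p else 0) \<in> borel_measurable borel"
    by (rule measurable_If[rotated 2, OF _ _ measurable_const]) simp
  then show ?thesis
    by (simp only: case_prod_beta' borel_prod)
qed

text \<open>The theorem of Archimedes in integrated form: projected to a diameter, the area of a
  sphere of radius \<open>r\<close> has the constant density \<open>2 * pi * r\<close>. A rotation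
  moves \<open>u\<close> to the first axis, and the slices are then assembled by Tonelli.\<close>

lemma distr_lborel_inner_norm:
  fixes u :: "real^3"
  assumes "norm u = 1"
  shows "distr lborel borel (\<lambda>l. (u \<bullet> l, norm l))
    = density (lborel \<Otimes>\<^sub>M lborel) (\<lambda>(y, r). ennreal (if \<bar>y\<bar> \<le> r then 2 * pi * r else 0))"
    (is "_ = density _ ?w")
proof -
  let ?e = "axis 1 1 :: real^3" and ?P = "\<lambda>(y :: real, z). vector [y, Re z, Im z] :: real^3"
  let ?S = "\<lambda>(y :: real, z :: complex). (y, sqrt (y\<^sup>2 + (norm z)\<^sup>2))"
  obtain T where T: "orthogonal_transformation T" "T ?e = u"
    using orthogonal_transformation_exists[of ?e u] assms by auto
  have Tm[measurable]: "T \<in> borel_measurable borel"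
    using T by (intro borel_measurable_continuous_onI linear_continuous_on)
      (simp add: linear_linear orthogonal_transformation_linear)
  have "linear ?P"
    by (rule linearI) (auto simp: vec_eq_iff forall_3)
  then have Pm: "?P \<in> borel_measurable borel"
    by (intro borel_measurable_continuous_onI linear_continuous_on)
      (simp add: linear_linear)
  have Pm': "?P \<in> borel_measurable (lborel \<Otimes>\<^sub>M lborel)"
    using Pm by (simp add: lborel_prod)
  have meas: "(\<lambda>l::real^3. (v \<bullet> l, norm l)) \<in> borel_measurable borel" for v
    by measurable
  have "?S \<in> borel_measurable borel"
    unfolding case_prod_beta' by (intro borel_measurable_continuous_onI continuous_intros)
  then have Sm: "?S \<in> borel_measurable (lborel \<Otimes>\<^sub>M lborel)"
    unfolding lborel_prod measurable_lborel2 .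
  have wm[measurable]: "?w \<in> borel_measurable (borel \<Otimes>\<^sub>M borel)"
    using measurable_compose[OF measurable_cone_weight measurable_ennreal]
    by (simp only: case_prod_beta')
  have "distr lborel borel (\<lambda>l. (u \<bullet> l, norm l)) = distr (distr lborel borel T) borel (\<lambda>l. (u \<bullet> l, norm l))"
    unfolding distr_lborel_orthogonal_transformation[OF T(1)] by (rule refl)
  also have "\<dots> = distr lborel borel (\<lambda>l. (?e \<bullet> l, norm l))"
  proof -
    have "u \<bullet> T l = ?e \<bullet> l" "norm (T l) = norm l" for l
      using T unfolding orthogonal_transformation_def by (auto simp: norm_eq_sqrt_inner)
    then show ?thesis by (subst distr_distr[OF meas]) (auto simp: comp_def)
  qed
  also have "\<dots> = distr (lborel \<Otimes>\<^sub>M lborel) borel ?S"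
  proof -
    have "(\<lambda>l. (?e \<bullet> l, norm l)) \<circ> ?P = ?S"
      by (auto simp: fun_eq_iff inner_axis' norm_vec_def L2_set_def sum_3 cmod_power2 add.assoc)
    then show ?thesis
      by (subst distr_lborel_real_complex[symmetric], subst distr_distr[OF meas Pm']) simp
  qed
  also have "\<dots> = density (lborel \<Otimes>\<^sub>M lborel) ?w"
  proof (rule measure_eqI)
    fix A :: "(real \<times> real) set" assume "A \<in> sets (distr (lborel \<Otimes>\<^sub>M lborel) borel ?S)"
    then have A': "A \<in> sets borel" by simp
    then have A[measurable]: "A \<in> sets (borel \<Otimes>\<^sub>M borel)" by (simp only: borel_prod)
    have Am: "Pair y -` A \<in> sets borel" for y
      using sets_Pair1[OF A, of y] by simp
    have "emeasure (distr (lborel \<Otimes>\<^sub>M lborel) borel ?S) A = emeasure (lborel \<Otimes>\<^sub>M lborel) (?S -` A)"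
      unfolding emeasure_distr[OF Sm A'] by (simp add: space_pair_measure)
    also have "\<dots> = (\<integral>\<^sup>+ y. emeasure lborel (Pair y -` (?S -` A)) \<partial>lborel)"
      using measurable_sets[OF Sm A'] by (intro lborel.emeasure_pair_measure_alt) (simp add: space_pair_measure)
    also have "\<dots> = (\<integral>\<^sup>+ y. emeasure (distr lborel borel (\<lambda>z::complex. sqrt (y\<^sup>2 + (norm z)\<^sup>2))) (Pair y -` A) \<partial>lborel)"
      using Am by (intro nn_integral_cong) (subst emeasure_distr, auto simp: vimage_def)
    also have "\<dots> = (\<integral>\<^sup>+ y. (\<integral>\<^sup>+ r. ?w (y, r) * indicator A (y, r) \<partial>lborel) \<partial>lborel)"
      unfolding distr_lborel_slice using Am
      by (intro nn_integral_cong) (subst emeasure_density, auto simp: indicator_def intro!: nn_integral_cong)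
    also have "\<dots> = (\<integral>\<^sup>+ p. ?w p * indicator A p \<partial>(lborel \<Otimes>\<^sub>M lborel))"
      by (subst lborel.nn_integral_fst[symmetric]) (auto)
    also have "\<dots> = emeasure (density (lborel \<Otimes>\<^sub>M lborel) ?w) A"
      by (subst emeasure_density) auto
    finally show "emeasure (distr (lborel \<Otimes>\<^sub>M lborel) borel ?S) A = emeasure (density (lborel \<Otimes>\<^sub>M lborel) ?w) A" .
  qed (simp add: lborel_prod)
  finally show ?thesis .
qed

section \<open>Reduction of the Fourier integral to a sine integral\<close>

lemma integral_exp_symmetric_interval:
  fixes \<tau> r :: real
  assumes "\<tau> \<noteq> 0" "0 \<le> r"
  shows "(LINT y|lborel. indicator {- r..r} y *\<^sub>R exp (\<i> * of_real (\<tau> * y))) = of_real (2 * sin (\<tau> * r) / \<tau>)"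
proof -
  have "((\<lambda>y. exp (\<i> * of_real (\<tau> * y)) / (\<i> * of_real \<tau>)) has_vector_derivative exp (\<i> * of_real (\<tau> * y))) (at y within {- r..r})" for y
    using assms by (auto intro!: derivative_eq_intros has_vector_derivative_real_field simp: field_simps)
  then have "(LINT y|lborel. indicator {- r..r} y *\<^sub>R exp (\<i> * of_real (\<tau> * y)))
    = exp (\<i> * of_real (\<tau> * r)) / (\<i> * of_real \<tau>) - exp (\<i> * of_real (\<tau> * (- r))) / (\<i> * of_real \<tau>)"
    using assms by (intro integral_FTC_Icc) (auto intro!: continuous_intros)
  also have "\<dots> = of_real (2 * sin (\<tau> * r) / \<tau>)"
  proof -
    have "exp (\<i> * of_real (\<tau> * x)) = of_real (cos (\<tau> * x)) + \<i> * of_real (sin (\<tau> * x))" for x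
      using exp_Euler[of "of_real (\<tau> * x)"] by (simp only: cos_of_real sin_of_real)
    from this[of r] this[of "- r"] show ?thesis
      using assms by (simp only:) (simp add: field_simps)
  qed
  finally show ?thesis .
qed

text \<open>In the coordinates \<open>y = u \<bullet> l\<close> and \<open>r = norm l\<close> the
  phase depends on \<open>y\<close> only. Integrating over \<open>y\<close> first gives
  \<open>2 * pi * r * f r * 2 * sin (\<tau> * r) / \<tau>\<close>.\<close>

lemma fourier_radial_real3:
  fixes f :: "real \<Rightarrow> real" and t :: "real^3"
  assumes f[measurable]: "f \<in> borel_measurable borel"
    and int: "set_integrable lborel {0<..} (\<lambda>r. r\<^sup>2 * f r)" and "t \<noteq> 0"
  shows "(LINT l|lborel. of_real (f (norm l)) * exp (\<i> * of_real (t \<bullet> l)))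
    = of_real (4 * pi / norm t) * (LINT r:{0<..}|lborel. of_real (r * f r * sin (norm t * r)))"
proof -
  define \<tau> where "\<tau> = norm t"
  define u where "u = t /\<^sub>R \<tau>"
  have "\<tau> > 0" using \<open>t \<noteq> 0\<close> by (simp add: \<tau>_def)
  have u: "norm u = 1" and t: "t = \<tau> *\<^sub>R u"
    using \<open>t \<noteq> 0\<close> by (simp_all add: u_def \<tau>_def)
  define h where "h = (\<lambda>(y, r). complex_of_real (f r) * exp (\<i> * of_real (\<tau> * y)))"
  define w where "w = (\<lambda>(y :: real, r). if \<bar>y\<bar> \<le> r then 2 * pi * r else 0)"
  have meas: "(\<lambda>l::real^3. (u \<bullet> l, norm l)) \<in> borel_measurable lborel"
    by measurable
  have hm[measurable]: "h \<in> borel_measurable (borel \<Otimes>\<^sub>M borel)"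
    unfolding h_def by measurable
  have hm': "h \<in> borel_measurable borel"
    using hm unfolding borel_prod .
  have wm[measurable]: "w \<in> borel_measurable (borel \<Otimes>\<^sub>M borel)"
    unfolding w_def by (rule measurable_cone_weight)
  have wm': "w \<in> borel_measurable (lborel \<Otimes>\<^sub>M lborel)" and hm'': "h \<in> borel_measurable (lborel \<Otimes>\<^sub>M lborel)"
    using wm hm by simp_all
  have w0: "0 \<le> w p" for p by (auto simp: w_def split: prod.splits)
  have whm: "(\<lambda>(r, y). w (y, r) *\<^sub>R h (y, r)) \<in> borel_measurable (lborel \<Otimes>\<^sub>M lborel)"
    using wm hm by simp
  have wy: "w (y, r) = indicator {- r..r} y * (2 * pi * r)" for y r :: real
    by (auto simp: w_def indicator_def)

  have "(LINT l|lborel. of_real (f (norm l)) * exp (\<i> * of_real (t \<bullet> l))) = (LINT l|lborel. h (u \<bullet> l, norm l))"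
    by (simp add: h_def t)
  also have "\<dots> = (LINT p|(distr lborel borel (\<lambda>l. (u \<bullet> l, norm l))). h p)"
    by (rule integral_distr[OF meas hm', symmetric])
  also have "\<dots> = (LINT p|(density (lborel \<Otimes>\<^sub>M lborel) (\<lambda>p. ennreal (w p))). h p)"
    unfolding distr_lborel_inner_norm[OF u] by (rule arg_cong2[where f="integral\<^sup>L"]) (auto simp: w_def intro!: arg_cong2[where f=density])
  also have "\<dots> = (LINT p|(lborel \<Otimes>\<^sub>M lborel). w p *\<^sub>R h p)"
    using hm'' wm' by (rule integral_density) (simp add: w0)
  also have "\<dots> = (LINT r|lborel. LINT y|lborel. w (y, r) *\<^sub>R h (y, r))"
  proof -
    \<comment> \<open>Absolute integrability over the cone reduces to the hypothesis on
      \<open>r^2 * f r\<close>, because the slice at \<open>r\<close> has length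
      \<open>2 * r\<close> and weight \<open>2 * pi * r\<close>. For negative \<open>r\<close> the
      slice is empty.\<close>
    have "integrable (lborel \<Otimes>\<^sub>M lborel) (\<lambda>(r, y). w (y, r) *\<^sub>R h (y, r))"
    proof (rule lborel_pair.Fubini_integrable[OF whm])
      have "(LINT y|lborel. norm ((\<lambda>(r, y). w (y, r) *\<^sub>R h (y, r)) (r, y)))
        = 4 * pi * norm (indicator {0<..} r *\<^sub>R (r\<^sup>2 * f r))" for r
      proof -
        have "(LINT y|lborel. norm ((\<lambda>(r, y). w (y, r) *\<^sub>R h (y, r)) (r, y)))
          = (LINT y|lborel. indicator {- r..r} y *\<^sub>R (2 * pi * \<bar>r\<bar> * \<bar>f r\<bar>))"
          by (intro Bochner_Integration.integral_cong) (auto simp: wy h_def norm_mult abs_mult)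
        also have "\<dots> = measure lborel {- r..r} *\<^sub>R (2 * pi * \<bar>r\<bar> * \<bar>f r\<bar>)"
          by (simp add: emeasure_lborel_Icc_eq)
        also have "\<dots> = 4 * pi * norm (indicator {0<..} r *\<^sub>R (r\<^sup>2 * f r))"
          by (auto simp: indicator_def abs_mult power2_eq_square)
        finally show ?thesis .
      qed
      then show "integrable lborel (\<lambda>r. LINT y|lborel. norm ((\<lambda>(r, y). w (y, r) *\<^sub>R h (y, r)) (r, y)))"
        using int unfolding set_integrable_def by simp
      have "integrable lborel (\<lambda>y. w (y, r) *\<^sub>R h (y, r))" for r
      proof -
        have "integrable lborel (\<lambda>y. indicator {- r..r} y *\<^sub>R (complex_of_real (2 * pi * r * f r) * exp (\<i> * of_real (\<tau> * y))))"
          by (intro borel_integrable_compact continuous_intros) auto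
        then show ?thesis
          by (simp add: wy h_def scaleR_conv_of_real mult_ac)
      qed
      then show "AE r in lborel. integrable lborel (\<lambda>y. (\<lambda>(r, y). w (y, r) *\<^sub>R h (y, r)) (r, y))"
        by simp
    qed
    from lborel_pair.integrable_product_swap[OF this]
    have "integrable (lborel \<Otimes>\<^sub>M lborel) (\<lambda>(y, r). w (y, r) *\<^sub>R h (y, r))"
      by (simp add: case_prod_beta')
    from lborel_pair.integral_snd[OF this] show ?thesis by (simp add: case_prod_beta')
  qed
  also have "\<dots> = (LINT r|lborel. of_real (4 * pi / norm t) * (indicator {0<..} r *\<^sub>R of_real (r * f r * sin (norm t * r))))"
  proof (rule Bochner_Integration.integral_cong)
    fix r :: real
    show "(LINT y|lborel. w (y, r) *\<^sub>R h (y, r)) = of_real (4 * pi / norm t) * (indicator {0<..} r *\<^sub>R of_real (r * f r * sin (norm t * r)))"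
    proof (cases "r > 0")
      case True
      have "(LINT y|lborel. w (y, r) *\<^sub>R h (y, r)) = (LINT y|lborel. complex_of_real (2 * pi * r * f r) * (indicator {- r..r} y *\<^sub>R exp (\<i> * of_real (\<tau> * y))))"
        by (intro Bochner_Integration.integral_cong) (auto simp: wy h_def scaleR_conv_of_real)
      also have "\<dots> = complex_of_real (2 * pi * r * f r) * of_real (2 * sin (\<tau> * r) / \<tau>)"
        using True \<open>\<tau> > 0\<close> by (subst integral_mult_right_zero, subst integral_exp_symmetric_interval) auto
      finally show ?thesis using True by (simp add: \<tau>_def)
    next
      case False
      then have "w (y, r) = 0" for y by (auto simp: w_def)
      then show ?thesis using False by simp
    qed
  qed simp
  also have "\<dots> = of_real (4 * pi / norm t) * (LINT r:{0<..}|lborel. of_real (r * f r * sin (norm t * r)))"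
    unfolding set_lebesgue_integral_def by (rule integral_mult_right_zero)
  finally show ?thesis .
qed

section \<open>The sine integral\<close>

lemma set_integrable_power_exp:
  fixes a :: real
  assumes "a > 0"
  shows "set_integrable lborel {0<..} (\<lambda>r. r ^ k * exp (- a * r))"
proof (rule set_integrable_bound)
  \<comment> \<open>Chosen so that \<open>k * c = a / 2\<close>: half of the decay absorbs the power
    through \<open>c * r \<le> exp (c * r)\<close>. The value 1 at \<open>k = 0\<close> keeps
    \<open>c\<close> positive.\<close>
  define c where "c = (if k = 0 then 1 else a / (2 * k))"
  have "c > 0" using assms by (simp add: c_def)
  have "((\<lambda>x::real. exp (- (a / 2) * x)) has_integral exp (- (a / 2) * 0) / (a / 2)) {0..}"
    using assms by (intro has_integral_exp_minus_to_infinity) auto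
  then have "set_integrable lebesgue {0..} (\<lambda>x::real. exp (- (a / 2) * x))"
    by (intro nonnegative_absolutely_integrable_1) auto
  then have "set_integrable lborel {0..} (\<lambda>x::real. exp (- (a / 2) * x))"
    unfolding set_integrable_def by (subst (asm) integrable_completion) simp_all
  then have "set_integrable lborel {0<..} (\<lambda>x::real. exp (- (a / 2) * x))"
    by (rule set_integrable_subset) auto
  then show "set_integrable lborel {0<..} (\<lambda>x::real. (1 / c ^ k) * exp (- (a / 2) * x))"
    by (rule set_integrable_mult_right)
  show "AE r in lborel. r \<in> {0<..} \<longrightarrow> norm (r ^ k * exp (- a * r)) \<le> norm ((1 / c ^ k) * exp (- (a / 2) * r))"
  proof (intro AE_I2 impI)
    fix r :: real assume "r \<in> {0<..}"
    then have "r > 0" by simp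
    have "c * r \<le> exp (c * r)" using exp_ge_add_one_self[of "c * r"] by linarith
    then have "(c * r) ^ k \<le> exp (c * r) ^ k" using \<open>c > 0\<close> \<open>r > 0\<close> by (intro power_mono) auto
    also have "\<dots> = exp (of_nat k * (c * r))" by (rule exp_of_nat_mult[symmetric])
    also have "\<dots> \<le> exp (a / 2 * r)" using assms \<open>r > 0\<close> by (simp add: c_def)
    finally have "r ^ k \<le> (1 / c ^ k) * exp (a / 2 * r)"
      using \<open>c > 0\<close> by (simp add: field_simps power_mult_distrib)
    then have "r ^ k * exp (- a * r) \<le> (1 / c ^ k) * exp (a / 2 * r) * exp (- a * r)"
      by (intro mult_right_mono) auto
    also have "\<dots> = (1 / c ^ k) * exp (- (a / 2) * r)"
      by (simp add: mult_exp_exp field_simps)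
    finally show "norm (r ^ k * exp (- a * r)) \<le> norm ((1 / c ^ k) * exp (- (a / 2) * r))"
      using \<open>c > 0\<close> \<open>r > 0\<close> by (simp add: abs_mult)
  qed
qed (simp add: set_borel_measurable_def)

text \<open>The Laplace transform of the square, at a complex argument so that an oscillating factor
  can be merged into the exponent.\<close>

lemma integral_square_exp:
  fixes b :: complex
  assumes "Re b > 0"
  shows "set_integrable lborel {0<..} (\<lambda>r. of_real (r\<^sup>2) * exp (- b * of_real r))"
    and "(LINT r:{0<..}|lborel. of_real (r\<^sup>2) * exp (- b * of_real r)) = 2 / b ^ 3"
proof -
  show int: "set_integrable lborel {0<..} (\<lambda>r. of_real (r\<^sup>2) * exp (- b * of_real r))"
    by (rule set_integrable_bound[OF set_integrable_power_exp[OF assms, of 2]])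
      (auto simp: norm_mult norm_power set_borel_measurable_def)
  have "b \<noteq> 0" using assms by auto
  \<comment> \<open>The antiderivative obtained by integrating by parts twice; it vanishes at
    infinity and equals \<open>- 2 / b ^ 3\<close> at 0.\<close>
  define F where "F = (\<lambda>r::real. - exp (- b * of_real r) * (of_real (r\<^sup>2) / b + 2 * of_real r / b\<^sup>2 + 2 / b ^ 3))"
  have F: "(F has_vector_derivative of_real (r\<^sup>2) * exp (- b * of_real r)) (at r)" for r
    unfolding F_def using \<open>b \<noteq> 0\<close>
    by (auto intro!: derivative_eq_intros has_vector_derivative_real_field simp: field_simps power2_eq_square power3_eq_cube)
  have norm_F: "norm (F r) \<le> exp (- Re b * r) * (r\<^sup>2 / norm b + 2 * r / (norm b)\<^sup>2 + 2 / norm b ^ 3)" if "r > 0" for r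
  proof -
    have "norm (of_real (r\<^sup>2) / b + 2 * of_real r / b\<^sup>2 + 2 / b ^ 3) \<le> r\<^sup>2 / norm b + 2 * r / (norm b)\<^sup>2 + 2 / norm b ^ 3"
      using that by (intro order.trans[OF norm_triangle_ineq] add_mono)
        (auto simp: norm_divide norm_power norm_mult)
    then show ?thesis
      unfolding F_def by (simp add: norm_mult)
  qed
  have "((\<lambda>r. exp (- Re b * r) * (r\<^sup>2 / norm b + 2 * r / (norm b)\<^sup>2 + 2 / norm b ^ 3)) \<longlongrightarrow> 0) at_top"
    using assms \<open>b \<noteq> 0\<close> by real_asymp
  then have "(F \<longlongrightarrow> 0) at_top"
    by (rule Lim_null_comparison[rotated]) (use norm_F in \<open>auto intro!: eventually_mono[OF eventually_gt_at_top[of 0]]\<close>)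
  then have lim_inf: "((F \<circ> real_of_ereal) \<longlongrightarrow> 0) (at_left \<infinity>)"
    by (simp add: ereal_tendsto_simps)
  have "(F \<longlongrightarrow> F 0) (at_right 0)"
    using has_vector_derivative_continuous[OF F[of 0]]
    by (auto simp: continuous_within intro: tendsto_within_subset)
  then have lim_0: "((F \<circ> real_of_ereal) \<longlongrightarrow> F 0) (at_right 0)"
    by (simp add: ereal_tendsto_simps zero_ereal_def)
  have "(LBINT r=0..\<infinity>. of_real (r\<^sup>2) * exp (- b * of_real r)) = 0 - F 0"
  proof (rule interval_integral_FTC_integrable[OF _ F _ _ lim_0 lim_inf])
    show "set_integrable lborel (einterval 0 \<infinity>) (\<lambda>r. of_real (r\<^sup>2) * exp (- b * of_real r))"
      using int by (simp add: zero_ereal_def)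
  qed (auto intro!: continuous_intros)
  then show "(LINT r:{0<..}|lborel. of_real (r\<^sup>2) * exp (- b * of_real r)) = 2 / b ^ 3"
    by (simp add: F_def interval_lebesgue_integral_def zero_ereal_def)
qed

section \<open>Reflection formulas for polygamma functions\<close>

text \<open>The logarithmic derivative of
  \<open>rGamma z * rGamma (1 - z) = sin (pi * z) / pi\<close>: both sides are differentiated and
  the derivatives compared.\<close>

lemma Digamma_reflection_complex:
  fixes z :: complex
  assumes "z \<notin> \<int>"
  shows "Digamma (1 - z) - Digamma z = of_real pi * cos (of_real pi * z) / sin (of_real pi * z)"
proof -
  have z: "z \<notin> \<int>\<^sub>\<le>\<^sub>0" "1 - z \<notin> \<int>\<^sub>\<le>\<^sub>0"
    using assms Ints_diff[OF Ints_1, of "1 - z"] nonpos_Ints_subset_Ints by auto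
  have sin: "sin (of_real pi * z) \<noteq> 0"
    using assms by (simp add: sin_eq_0 mult.commute) (auto simp: Ints_def)
  have "((\<lambda>z. rGamma z * rGamma (1 - z)) has_field_derivative
      rGamma z * rGamma (1 - z) * (Digamma (1 - z) - Digamma z)) (at z)"
    using z by (auto intro!: derivative_eq_intros simp: algebra_simps)
  then have "((\<lambda>z. sin (of_real pi * z) / of_real pi) has_field_derivative
      sin (of_real pi * z) / of_real pi * (Digamma (1 - z) - Digamma z)) (at z)"
    by (simp add: rGamma_reflection_complex)
  moreover have "((\<lambda>z. sin (of_real pi * z) / of_real pi) has_field_derivative cos (of_real pi * z)) (at z)"
    by (auto intro!: derivative_eq_intros)
  ultimately have "sin (of_real pi * z) / of_real pi * (Digamma (1 - z) - Digamma z) = cos (of_real pi * z)"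
    by (rule DERIV_unique)
  then show ?thesis using sin by (simp add: field_simps)
qed

text \<open>The digamma reflection differentiated twice. The formulas hold on the open complement of
  the integers, so they may be differentiated there; each derivative of a term in
  \<open>1 - z\<close> changes its sign.\<close>

lemma Polygamma_2_reflection_complex:
  fixes z :: complex
  assumes "z \<notin> \<int>"
  shows "Polygamma 2 (1 - z) - Polygamma 2 z = 2 * of_real pi ^ 3 * cos (of_real pi * z) / sin (of_real pi * z) ^ 3"
proof -
  have op: "open (- \<int> :: complex set)" by (simp add: open_Compl closed_Ints)
  have np: "z \<notin> \<int>\<^sub>\<le>\<^sub>0" "1 - z \<notin> \<int>\<^sub>\<le>\<^sub>0" if "z \<notin> \<int>" for z :: complex
    using that Ints_diff[OF Ints_1, of "1 - z"] nonpos_Ints_subset_Ints by auto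
  have sin: "sin (of_real pi * z) \<noteq> 0" if "z \<notin> \<int>" for z :: complex
    using that by (simp add: sin_eq_0 mult.commute) (auto simp: Ints_def)
  have 1: "- Polygamma 1 (1 - z) - Polygamma 1 z = - (of_real pi)\<^sup>2 / sin (of_real pi * z) ^ 2" if z: "z \<notin> \<int>" for z :: complex
  proof -
    have "((\<lambda>z. Digamma (1 - z) - Digamma z) has_field_derivative - Polygamma 1 (1 - z) - Polygamma 1 z) (at z)"
      using np[OF z] by (auto intro!: derivative_eq_intros)
    then have "((\<lambda>z. of_real pi * cos (of_real pi * z) / sin (of_real pi * z)) has_field_derivative - Polygamma 1 (1 - z) - Polygamma 1 z) (at z)"
      by (rule has_field_derivative_transform_within_open[OF _ op]) (use z Digamma_reflection_complex in auto)
    moreover have d: "((\<lambda>z. of_real pi * cos (of_real pi * z) / sin (of_real pi * z)) has_field_derivative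
        (- (sin (of_real pi * z) * of_real pi * of_real pi * sin (of_real pi * z)) -
          of_real pi * cos (of_real pi * z) * (cos (of_real pi * z) * of_real pi)) /
        (sin (of_real pi * z) * sin (of_real pi * z))) (at z)"
      using sin[OF z] by (auto intro!: derivative_eq_intros)
    moreover have "- (s * p * p * s) - p * c * (c * p) = - p\<^sup>2" if "s\<^sup>2 + c\<^sup>2 = 1" for s c p :: complex
      using that by algebra
    note d[unfolded this[OF sin_cos_squared_add]]
    ultimately have "- Polygamma 1 (1 - z) - Polygamma 1 z = - (of_real pi)\<^sup>2 / (sin (of_real pi * z) * sin (of_real pi * z))"
      by (blast intro: DERIV_unique)
    then show ?thesis by (simp add: power2_eq_square)
  qed
  have "((\<lambda>z. - Polygamma 1 (1 - z) - Polygamma 1 z) has_field_derivative Polygamma 2 (1 - z) - Polygamma 2 z) (at z)"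
    using np[OF assms] by (auto intro!: derivative_eq_intros simp: numeral_2_eq_2)
  then have "((\<lambda>z. - (of_real pi)\<^sup>2 / sin (of_real pi * z) ^ 2) has_field_derivative Polygamma 2 (1 - z) - Polygamma 2 z) (at z)"
    by (rule has_field_derivative_transform_within_open[OF _ op]) (use assms 1 in auto)
  moreover have "((\<lambda>z. - (of_real pi)\<^sup>2 / sin (of_real pi * z) ^ 2) has_field_derivative 2 * of_real pi ^ 3 * cos (of_real pi * z) / sin (of_real pi * z) ^ 3) (at z)"
    using sin[OF assms]
    by (auto intro!: derivative_eq_intros) (simp add: field_simps power2_eq_square power3_eq_cube power4_eq_xxxx)
  ultimately show ?thesis by (rule DERIV_unique)
qed

section \<open>Evaluation of the integrals against 1 / sinh\<close>

text \<open>For \<open>r > 0\<close>, 1 / sinh r is twice the sum of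
  \<open>exp (- (2 * n + 1) * r)\<close>. With the phase included, the exponents become
  \<open>b n = 2 * (z + n)\<close>, and each term integrates to
  \<open>4 / b n ^ 3 = 1 / (2 * (z + n) ^ 3)\<close>, half a term of the series for
  \<open>Polygamma 2 z\<close>.\<close>

lemma integral_square_exp_over_sinh:
  fixes \<tau> :: real
  shows "(LINT r:{0<..}|lborel. of_real (r\<^sup>2 / sinh r) * exp (\<i> * of_real (\<tau> * r)))
    = - Polygamma 2 (1 / 2 - \<i> * of_real \<tau> / 2) / 4"
    and "set_integrable lborel {0<..} (\<lambda>r. of_real (r\<^sup>2 / sinh r) * exp (\<i> * of_real (\<tau> * r)))"
proof -
  define z where "z = 1 / 2 - \<i> * of_real \<tau> / 2"
  define b where "b n = 2 * (z + of_nat n)" for n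
  have Re_b: "Re (b n) = 2 * n + 1" for n
    by (simp add: b_def z_def)
  then have Re_b_pos: "Re (b n) > 0" for n
    by simp
  define f where "f n = (\<lambda>r::real. indicator {0<..} r *\<^sub>R (2 * (of_real (r\<^sup>2) * exp (- b n * of_real r))))" for n
  have int_f: "integrable lborel (f n)" for n
    using integral_square_exp(1)[OF Re_b_pos[of n]]
    unfolding f_def set_integrable_def scaleR_conv_of_real mult.left_commute[of _ 2] by simp
  have integral_f: "(LINT r|lborel. f n r) = inverse ((z + of_nat n) ^ Suc 2) / 2" for n
  proof -
    have "(LINT r|lborel. f n r) = 2 * (LINT r:{0<..}|lborel. of_real (r\<^sup>2) * exp (- b n * of_real r))"
      unfolding f_def set_lebesgue_integral_def scaleR_conv_of_real mult.left_commute[of _ 2] by simp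
    also have "\<dots> = inverse ((z + of_nat n) ^ Suc 2) / 2"
    proof -
      have "b n ^ 3 = 8 * (z + of_nat n) ^ 3"
        unfolding b_def power_mult_distrib by simp
      then show ?thesis
        unfolding integral_square_exp(2)[OF Re_b_pos] by (simp add: inverse_eq_divide)
    qed
    finally show ?thesis .
  qed
  have sums_f: "(\<lambda>n. f n r) sums (indicator {0<..} r *\<^sub>R (of_real (r\<^sup>2 / sinh r) * exp (\<i> * of_real (\<tau> * r))))" for r
  proof (cases "r > 0")
    case True
    have "(\<lambda>n. exp (- 2 * complex_of_real r) ^ n) sums (1 / (1 - exp (- 2 * complex_of_real r)))"
      by (rule geometric_sums) (use True in simp)
    then have "(\<lambda>n. 2 * of_real (r\<^sup>2) * exp (- of_real r + \<i> * of_real (\<tau> * r)) * exp (- 2 * complex_of_real r) ^ n)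
      sums (2 * of_real (r\<^sup>2) * exp (- of_real r + \<i> * of_real (\<tau> * r)) * (1 / (1 - exp (- 2 * complex_of_real r))))"
      by (rule sums_mult)
    moreover have "2 * of_real (r\<^sup>2) * exp (- of_real r + \<i> * of_real (\<tau> * r)) * exp (- 2 * complex_of_real r) ^ n = f n r" for n
      using True by (simp add: f_def b_def z_def mult_exp_exp algebra_simps flip: exp_of_nat_mult)
    moreover have "2 * of_real (r\<^sup>2) * exp (- of_real r + \<i> * of_real (\<tau> * r)) * (1 / (1 - exp (- 2 * complex_of_real r)))
      = of_real (r\<^sup>2 / sinh r) * exp (\<i> * of_real (\<tau> * r))"
    proof -
      have e: "exp (- 2 * complex_of_real r) = of_real (exp (- r)) * of_real (exp (- r))"
      proof -
        have "exp (- 2 * complex_of_real r) = of_real (exp (- 2 * r))"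
          by (simp add: exp_of_real[symmetric])
        also have "exp (- 2 * r) = exp (- r) * exp (- r)"
          by (simp add: mult_exp_exp)
        finally show ?thesis by simp
      qed
      have s: "sinh r = (exp r - exp (- r)) / 2" by (simp add: sinh_def)
      have "exp r * exp (- r) = 1" by (simp add: mult_exp_exp)
      then have *: "1 - exp (- r) * exp (- r) = 2 * exp (- r) * sinh r"
        unfolding s by algebra
      have "sinh r \<noteq> 0" using True by simp
      have "1 - exp (- 2 * complex_of_real r) = of_real (2 * exp (- r) * sinh r)"
        unfolding *[symmetric] e by simp
      then show ?thesis using \<open>sinh r \<noteq> 0\<close>
        by (simp only: exp_add) (simp add: field_simps flip: exp_of_real)
    qed
    ultimately show ?thesis using True by simp
  qed (simp add: f_def)
  have sum_nf: "summable (\<lambda>n. norm (f n r))" for r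
  proof -
    have "(\<lambda>n. norm (f n r)) = (\<lambda>n. indicator {0<..} r * (2 * r\<^sup>2 * exp (- r)) * exp (- 2 * r) ^ n)"
      by (auto simp: f_def norm_mult norm_power Re_b indicator_def fun_eq_iff mult_exp_exp algebra_simps exp_of_nat_mult[symmetric])
    moreover have "summable (\<lambda>n. indicator {0<..} r * (2 * r\<^sup>2 * exp (- r)) * exp (- 2 * r) ^ n)"
    proof (cases "r > 0")
      case True
      then show ?thesis by (intro summable_mult summable_geometric) simp
    qed simp
    ultimately show ?thesis by simp
  qed
  \<comment> \<open>This justifies termwise integration. The norms do not see the phase, so their
    integrals are the terms at \<open>\<tau> = 0\<close>, summed by the polygamma series at
    1/2.\<close>
  have "summable (\<lambda>n. inverse ((1 / 2 + of_nat n :: real) ^ Suc 2))"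
    using Polygamma_LIMSEQ[of "1 / 2 :: real" 2] by (auto simp: sums_iff)
  moreover have "(LINT r|lborel. norm (f n r)) = inverse ((1 / 2 + of_nat n :: real) ^ Suc 2) / 2" for n
  proof -
    have "of_real (LINT r|lborel. norm (f n r)) = (LINT r|lborel. complex_of_real (norm (f n r)))"
      by simp
    also have "\<dots> = 2 * (LINT r:{0<..}|lborel. of_real (r\<^sup>2) * exp (- of_real (2 * n + 1) * of_real r))"
    proof -
      have "complex_of_real (norm (f n r)) = 2 * (indicator {0<..} r *\<^sub>R (of_real (r\<^sup>2) * exp (- of_real (2 * n + 1) * of_real r)))" for r
      proof -
        have "exp (- of_real (2 * n + 1) * complex_of_real r) = of_real (exp (- real (2 * n + 1) * r))"
          by (simp only: exp_of_real of_real_mult[symmetric] of_real_minus[symmetric])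
        then show ?thesis
          by (simp only:) (auto simp: f_def norm_mult norm_power Re_b indicator_def algebra_simps)
      qed
      then show ?thesis
        unfolding set_lebesgue_integral_def by (simp only: integral_mult_right_zero)
    qed
    also have "\<dots> = of_real (inverse ((1 / 2 + of_nat n :: real) ^ Suc 2) / 2)"
    proof -
      have "real (2 * n + 1) ^ 3 = (2 * (1 / 2 + real n)) ^ 3" by simp
      also have "\<dots> = 8 * (1 / 2 + real n) ^ 3" unfolding power_mult_distrib by simp
      finally have "complex_of_real (real (2 * n + 1)) ^ 3 = of_real (8 * (1 / 2 + real n) ^ 3)"
        by (simp only: of_real_power[symmetric])
      then show ?thesis
        by (subst integral_square_exp(2)) (simp_all add: inverse_eq_divide del: of_nat_add of_nat_mult)
    qed
    finally show ?thesis by (simp only: of_real_eq_iff)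
  qed
  ultimately have sum_int: "summable (\<lambda>n. LINT r|lborel. norm (f n r))"
    by (simp only: summable_divide)
  have suminf_f: "(\<Sum>n. f n r) = indicator {0<..} r *\<^sub>R (of_real (r\<^sup>2 / sinh r) * exp (\<i> * of_real (\<tau> * r)))" for r
    using sums_f[of r] by (simp add: sums_iff)
  have "(\<lambda>n. LINT r|lborel. f n r) sums (LINT r|lborel. (\<Sum>n. f n r))"
    using int_f sum_nf sum_int by (intro sums_integral) auto
  moreover have "Re z = 1 / 2" by (simp add: z_def)
  then have "z \<noteq> 0" by auto
  then have "(\<lambda>n. inverse ((z + of_nat n) ^ Suc 2) / 2) sums ((- 1) ^ Suc 2 * Polygamma 2 z / fact 2 / 2)"
    by (intro sums_divide Polygamma_LIMSEQ) auto
  ultimately show "(LINT r:{0<..}|lborel. of_real (r\<^sup>2 / sinh r) * exp (\<i> * of_real (\<tau> * r)))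
    = - Polygamma 2 (1 / 2 - \<i> * of_real \<tau> / 2) / 4"
    unfolding integral_f suminf_f set_lebesgue_integral_def
    by (auto simp: z_def[symmetric] fact_numeral dest: sums_unique2)
  have "integrable lborel (\<lambda>r. \<Sum>n. f n r)"
    using int_f sum_nf sum_int by (intro integrable_suminf) auto
  then show "set_integrable lborel {0<..} (\<lambda>r. of_real (r\<^sup>2 / sinh r) * exp (\<i> * of_real (\<tau> * r)))"
    unfolding suminf_f set_integrable_def .
qed

text \<open>The sine is a difference of exponentials with frequencies \<open>\<tau>\<close> and
  \<open>- \<tau>\<close>. Changing the sign of \<open>\<tau>\<close> turns \<open>z\<close> into
  \<open>1 - z\<close>, so the two polygamma values combine by reflection.\<close>

lemma integral_square_sin_over_sinh:
  fixes \<tau> :: real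
  shows "(LINT r:{0<..}|lborel. of_real (r\<^sup>2 / sinh r * sin (\<tau> * r)))
    = complex_of_real (pi ^ 3 / 4 * sinh (pi * \<tau> / 2) / cosh (pi * \<tau> / 2) ^ 3)"
proof -
  define z where "z = 1 / 2 - \<i> * of_real \<tau> / 2"
  define y where "y = pi * \<tau> / 2"
  have sh: "complex_of_real (sinh y) = - \<i> * sin (\<i> * of_real y)"
    unfolding sinh_conv_sin[symmetric] by (simp add: sinh_field_def exp_of_real[symmetric])
  have ch: "complex_of_real (cosh y) = cos (\<i> * of_real y)"
    unfolding cosh_conv_cos[symmetric] by (simp add: cosh_field_def exp_of_real[symmetric])
  let ?I = "\<lambda>\<tau>. (LINT r:{0<..}|lborel. of_real (r\<^sup>2 / sinh r) * exp (\<i> * of_real (\<tau> * r)))"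
  have "(LINT r:{0<..}|lborel. of_real (r\<^sup>2 / sinh r * sin (\<tau> * r)))
    = (LINT r:{0<..}|lborel. (of_real (r\<^sup>2 / sinh r) * exp (\<i> * of_real (\<tau> * r)) - of_real (r\<^sup>2 / sinh r) * exp (\<i> * of_real (- \<tau> * r))) * (1 / (2 * \<i>)))"
  proof -
    have *: "complex_of_real (sin x) = (exp (\<i> * of_real x) - exp (\<i> * of_real (- x))) / (2 * \<i>)" for x
      by (simp add: sin_exp_eq flip: sin_of_real)
    have "complex_of_real (r\<^sup>2 / sinh r * sin (\<tau> * r)) = (of_real (r\<^sup>2 / sinh r) * exp (\<i> * of_real (\<tau> * r))
        - of_real (r\<^sup>2 / sinh r) * exp (\<i> * of_real (- \<tau> * r))) * (1 / (2 * \<i>))" for r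
      by (simp only: of_real_mult[of "_ / _"] *) (simp add: algebra_simps diff_divide_distrib)
    then show ?thesis by (simp only:)
  qed
  also have "\<dots> = (?I \<tau> - ?I (- \<tau>)) * (1 / (2 * \<i>))"
    by (simp only: set_integral_mult_left set_integral_diff(2)[OF integral_square_exp_over_sinh(2) integral_square_exp_over_sinh(2)])
  also have "\<dots> = (Polygamma 2 (1 - z) - Polygamma 2 z) / (8 * \<i>)"
    unfolding integral_square_exp_over_sinh(1) by (simp add: z_def field_simps)
  also have "\<dots> = of_real pi ^ 3 / 4 * (cos (of_real pi * z) / \<i>) / sin (of_real pi * z) ^ 3"
  proof -
    have "Re z = 1 / 2" by (simp add: z_def)
    have "z \<notin> \<int>"
    proof
      assume "z \<in> \<int>"
      then obtain n where "z = of_int n" by (auto simp: Ints_def)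
      with \<open>Re z = 1 / 2\<close> have "real_of_int (2 * n) = real_of_int 1" by simp
      then have "2 * n = 1" by (simp only: of_int_eq_iff)
      then show False by presburger
    qed
    note Polygamma_2_reflection_complex[OF this]
    moreover have "2 * p * c / s / (8 * j) = p / 4 * (c / j) / s" for p c s j :: complex
      by (cases "j = 0"; cases "s = 0") (simp_all add: field_simps)
    ultimately show ?thesis by (simp only:)
  qed
  \<comment> \<open>The real part 1/2 becomes a shift by a quarter period, which exchanges sine and
    cosine; the remaining imaginary argument makes them hyperbolic.\<close>
  also have "of_real pi * z = of_real (pi / 2) - \<i> * of_real y"
    by (simp add: z_def y_def field_simps)
  also have "cos (of_real (pi / 2) - \<i> * of_real y) / \<i> = of_real (sinh y)"
    unfolding cos_diff cos_of_real sin_of_real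
    by (simp add: sh)
  also have "sin (of_real (pi / 2) - \<i> * of_real y) = of_real (cosh y)"
    unfolding sin_diff cos_of_real sin_of_real
    by (simp add: ch)
  finally show ?thesis by (simp add: y_def)
qed

section \<open>Small time asymptotics\<close>

text \<open>A rearrangement of \<open>1 + 2 * x \<le> exp (2 * x)\<close>. It bounds the kernel near
  0 and at infinity at once by integrable functions.\<close>

lemma x_over_sinh_le:
  fixes x :: real
  assumes "x > 0"
  shows "x / sinh x \<le> (1 + 2 * x) * exp (- x)"
proof -
  have "sinh x > 0" using assms by simp
  have "1 + 2 * x \<le> exp (2 * x)" by (rule exp_ge_add_one_self)
  then have "(1 + 2 * x) * exp (- 2 * x) \<le> exp (2 * x) * exp (- 2 * x)"
    by (intro mult_right_mono) auto
  also have "\<dots> = 1" by (simp add: mult_exp_exp)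
  finally have "(1 + 2 * x) * exp (- 2 * x) \<le> 1" .
  then have "x \<le> (1 + 2 * x) * ((1 - exp (- 2 * x)) / 2)"
    using assms by (simp add: algebra_simps)
  also have "(1 - exp (- 2 * x)) / 2 = exp (- x) * sinh x"
    by (simp add: sinh_field_def algebra_simps mult_exp_exp diff_divide_distrib)
  finally show ?thesis
    using \<open>sinh x > 0\<close> by (simp add: field_simps)
qed

text \<open>For \<open>x = 0\<close> the real part of the exponent vanishes and only the radial
  weight and the phase remain. The factors \<open>4 * pi\<close> of the Fourier reduction and
  \<open>pi ^ 3 / 4\<close> of the sine integral combine to \<open>pi ^ 4\<close>.\<close>

lemma p_kernel_vertical:
  assumes "t \<noteq> 0"
  shows "p_kernel 0 t = of_real (pi ^ 4 / norm t * sinh (pi * norm t / 2) / cosh (pi * norm t / 2) ^ 3)"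
proof -
  define f where "f = (\<lambda>r::real. r / sinh r)"
  have f[measurable]: "f \<in> borel_measurable borel"
  proof -
    have "(sinh :: real \<Rightarrow> real) \<in> borel_measurable borel"
      by (intro borel_measurable_continuous_onI continuous_on_sinh continuous_on_id)
    then show ?thesis unfolding f_def by measurable
  qed
  have int: "set_integrable lborel {0<..} (\<lambda>r. r\<^sup>2 * f r)"
  proof (rule set_integrable_bound)
    show "set_integrable lborel {0<..} (\<lambda>r::real. r ^ 2 * exp (- 1 * r) + 2 * (r ^ 3 * exp (- 1 * r)))"
      by (intro set_integral_add(1) set_integrable_mult_right set_integrable_power_exp) auto
    show "AE r in lborel. r \<in> {0<..} \<longrightarrow> norm (r\<^sup>2 * f r) \<le> norm (r ^ 2 * exp (- 1 * r) + 2 * (r ^ 3 * exp (- 1 * r)))"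
    proof (intro AE_I2 impI)
      fix r :: real assume "r \<in> {0<..}"
      then have "r > 0" by simp
      have "r\<^sup>2 * f r \<le> r\<^sup>2 * ((1 + 2 * r) * exp (- r))"
        unfolding f_def by (intro mult_left_mono x_over_sinh_le \<open>r > 0\<close>) auto
      also have "\<dots> = r ^ 2 * exp (- 1 * r) + 2 * (r ^ 3 * exp (- 1 * r))"
        by (simp add: algebra_simps power2_eq_square power3_eq_cube)
      finally show "norm (r\<^sup>2 * f r) \<le> norm (r ^ 2 * exp (- 1 * r) + 2 * (r ^ 3 * exp (- 1 * r)))"
        using \<open>r > 0\<close> by (simp add: f_def)
    qed
  qed (simp add: set_borel_measurable_def)
  have "p_kernel 0 t = (LINT l|lborel. of_real (f (norm l)) * exp (\<i> * of_real (t \<bullet> l)))"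
    by (simp add: p_kernel_def f_def)
  also have "\<dots> = of_real (4 * pi / norm t) * (LINT r:{0<..}|lborel. of_real (r * f r * sin (norm t * r)))"
    by (rule fourier_radial_real3[OF f int assms])
  also have "(\<lambda>r. complex_of_real (r * f r * sin (norm t * r))) = (\<lambda>r. of_real (r\<^sup>2 / sinh r * sin (norm t * r)))"
    by (simp add: f_def power2_eq_square)
  also have "complex_of_real (4 * pi / norm t) * (LINT r:{0<..}|lborel. of_real (r\<^sup>2 / sinh r * sin (norm t * r)))
    = of_real (pi ^ 4 / norm t * sinh (pi * norm t / 2) / cosh (pi * norm t / 2) ^ 3)"
    unfolding integral_square_sin_over_sinh of_real_mult[symmetric] by (simp add: eval_nat_numeral)
  finally show ?thesis .
qed

lemma tendsto_sinh_cosh_exp: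
  "((\<lambda>y::real. sinh y / cosh y ^ 3 * exp (2 * y) / 4) \<longlongrightarrow> 1) at_top"
proof -
  \<comment> \<open>Extracting the leading exponentials: with \<open>q = exp (- 2 * y)\<close>, sinh
    and cosh are \<open>exp y / 2\<close> times \<open>1 - q\<close> and \<open>1 + q\<close>. The
    powers of 2 leave the factor 4 that is divided out here.\<close>
  have "sinh y / cosh y ^ 3 * exp (2 * y) / 4 = (1 - exp (- 2 * y)) / (1 + exp (- 2 * y)) ^ 3" for y :: real
  proof -
    define E where "E = exp y"
    have "E > 0" by (simp add: E_def)
    have e: "exp (- y) = 1 / E" "exp (2 * y) = E\<^sup>2" "exp (- 2 * y) = 1 / E\<^sup>2"
      by (simp_all add: E_def exp_minus field_simps power2_eq_square mult_exp_exp)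
    have s: "sinh y = (E\<^sup>2 - 1) / (2 * E)" "cosh y = (E\<^sup>2 + 1) / (2 * E)"
      using \<open>E > 0\<close> by (simp_all add: sinh_field_def cosh_field_def e E_def[symmetric] field_simps power2_eq_square)
    have "E\<^sup>2 + 1 > 0" using \<open>E > 0\<close> by (simp add: add_pos_pos)
    then show ?thesis
      unfolding s e using \<open>E > 0\<close> by (simp add: divide_simps) (simp add: eval_nat_numeral algebra_simps)
  qed
  moreover have "((\<lambda>y::real. exp (- 2 * y)) \<longlongrightarrow> 0) at_top"
    by (intro filterlim_compose[OF exp_at_bot] filterlim_tendsto_neg_mult_at_bot[OF tendsto_const] filterlim_ident) auto
  then have "((\<lambda>y::real. (1 - exp (- 2 * y)) / (1 + exp (- 2 * y)) ^ 3) \<longlongrightarrow> (1 - 0) / (1 + 0) ^ 3) at_top"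
    by (intro tendsto_intros) auto
  ultimately show ?thesis by simp
qed

theorem corollary11p11:
  fixes C :: real and x t :: "real^3"
  assumes "C > 0" and "x = 0" and "t \<noteq> 0"
  shows "\<exists>\<epsilon> :: real \<Rightarrow> real. (\<epsilon> \<longlongrightarrow> 0) (at_right 0) \<and>
    (\<forall>h>0. heat_kernel C h x t =
       complex_of_real (C * (4 * pi ^ 4) * h powr (- 7/2) * (1 / norm t) *
         exp (- (cc_dist (x, t))\<^sup>2 / (4 * h)) * (1 + \<epsilon> h)))"
proof (intro exI conjI allI impI)
  define y where "y h = pi * norm t / 2 * inverse h" for h :: real
  \<comment> \<open>The exact relative error: since \<open>p_kernel_vertical\<close> is an identity,
    the quotient by the claimed main term depends on \<open>h\<close> only through
    \<open>y h\<close>, which tends to infinity.\<close>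
  define \<epsilon> where "\<epsilon> h = sinh (y h) / cosh (y h) ^ 3 * exp (2 * y h) / 4 - 1" for h
  have "filterlim y at_top (at_right 0)"
    unfolding y_def using \<open>t \<noteq> 0\<close>
    by (intro filterlim_tendsto_pos_mult_at_top[OF tendsto_const _ filterlim_inverse_at_top_right]) auto
  from tendsto_diff[OF filterlim_compose[OF tendsto_sinh_cosh_exp this] tendsto_const[of 1]]
  show "(\<epsilon> \<longlongrightarrow> 0) (at_right 0)"
    unfolding \<epsilon>_def by simp
  fix h :: real assume "h > 0"
  \<comment> \<open>The squared distance is \<open>4 * pi * norm t\<close>, so the geometric
    exponent \<open>pi * norm t / h\<close> matches the decay rate of the kernel.\<close>
  have d: "(cc_dist (x, t))\<^sup>2 / (4 * h) = 2 * y h"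
    using \<open>h > 0\<close> by (simp add: \<open>x = 0\<close> cc_dist_vertical y_def field_simps)
  have norm: "norm ((1 / h) *\<^sub>R t) = norm t / h"
    using \<open>h > 0\<close> by simp
  \<comment> \<open>The extra factor \<open>h\<close> comes from the prefactor
    \<open>1 / norm t\<close> of the kernel, evaluated at \<open>t / h\<close>.\<close>
  have "h powr (- 7 / 2) = h powr (- 9 / 2 + 1)" by simp
  also have "\<dots> = h powr (- 9 / 2) * h"
    using \<open>h > 0\<close> by (simp only: powr_add powr_one)
  finally have powr: "h powr (- 7 / 2) = h powr (- 9 / 2) * h" .
  have exp: "exp (- (cc_dist (x, t))\<^sup>2 / (4 * h)) * exp (2 * y h) = 1"
    using d by (simp add: mult_exp_exp)
  have "heat_kernel C h x t = of_real (C * h powr (- 9 / 2)) * p_kernel 0 ((1 / h) *\<^sub>R t)"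
    by (simp add: heat_kernel_def \<open>x = 0\<close>)
  also have "\<dots> = of_real (C * h powr (- 9 / 2) * (pi ^ 4 / (norm t / h) * sinh (y h) / cosh (y h) ^ 3))"
    using p_kernel_vertical[of "(1 / h) *\<^sub>R t"] \<open>t \<noteq> 0\<close> \<open>h > 0\<close> by (simp add: y_def field_simps)
  also have "C * h powr (- 9 / 2) * (pi ^ 4 / (norm t / h) * sinh (y h) / cosh (y h) ^ 3)
    = C * (4 * pi ^ 4) * h powr (- 7/2) * (1 / norm t) * (sinh (y h) / cosh (y h) ^ 3 / 4)
      * (exp (- (cc_dist (x, t))\<^sup>2 / (4 * h)) * exp (2 * y h))"
    unfolding powr exp using \<open>h > 0\<close> by simp
  also have "\<dots> = C * (4 * pi ^ 4) * h powr (- 7/2) * (1 / norm t) *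
         exp (- (cc_dist (x, t))\<^sup>2 / (4 * h)) * (1 + \<epsilon> h)"
    by (simp add: \<epsilon>_def)
  finally show "heat_kernel C h x t = complex_of_real (C * (4 * pi ^ 4) * h powr (- 7/2) * (1 / norm t) *
         exp (- (cc_dist (x, t))\<^sup>2 / (4 * h)) * (1 + \<epsilon> h))" .
qed

end
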